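(* Let $q$ be an odd prime power, $\mu\in\mathbb F_q^\times$, and $\Delta\in\mathbb F_{q^2}^\times$ with $\Delta^q=-\Delta$. Let $\chi\neq1$ be a multiplicative character of $\mathbb F_{q^4}^\times$ of order $d$, and let $S_\chi=\sum_{P\in\mathscr C_\Delta(\mathbb F_q)}\chi(\mu b(P))$. Then $$|S_\chi|\leq\begin{cases}6\sqrt q,&d\mid(q+1)(q^2+1),\\ 8\sqrt q,&d\nmid(q+1)(q^2+1).\end{cases}$$
   Context: Set $V_-=\{w\in\mathbb F_{q^4}:w^{q^2}=-w\}$ (a two-dimensional $\mathbb F_q$-space) and $\Phi(w)=w^2-w^{2q}$. $\mathscr C_\Delta$ is the smooth projective conic over $\mathbb F_q$ with $\mathscr C_\Delta(\mathbb F_q)=\{[u:w]\in\mathbb P(\mathbb F_q\oplus V_-):\Phi(w)=\Delta u^2\}$; every such point has $u\neq0$. The root function is $b([u:w])=(w-u/2)/u\in\mathbb F_{q^4}$. Characters are complex-valued and extended by $\chi(0)=0$. *)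

theory Defs
  imports Complex_Main "HOL-Library.Cardinality" "HOL-Number_Theory.Prime_Powers"
begin

(* The type 'a plays the role of the finite field with q^4 elements. Every subfield of a finite
   field is determined by its order m and is the fixed set of x \<mapsto> x^m; so the subfields of order
   q and q^2 are subfield_of_order q and subfield_of_order (q^2). *)
definition subfield_of_order :: "nat \<Rightarrow> 'a::field set" where
  "subfield_of_order m = {x. x ^ m = x}"

definition V_minus :: "nat \<Rightarrow> 'a::field set" where
  "V_minus q = {w. w ^ (q ^ 2) = - w}"

definition Phi :: "nat \<Rightarrow> 'a::field \<Rightarrow> 'a" where
  "Phi q w = w ^ 2 - w ^ (2 * q)"

definition proj_vectors :: "nat \<Rightarrow> ('a::field \<times> 'a) set" where
  "proj_vectors q = (subfield_of_order q \<times> V_minus q) - {(0, 0)}"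

definition proj_rel :: "nat \<Rightarrow> (('a::field \<times> 'a) \<times> ('a \<times> 'a)) set" where
  "proj_rel q = {((u, w), (u', w')). (u, w) \<in> proj_vectors q \<and> (u', w') \<in> proj_vectors q \<and>
     (\<exists>c \<in> subfield_of_order q - {0}. u' = c * u \<and> w' = c * w)}"

(* Points are the classes [u:w] themselves, as sets of representatives. *)
definition proj_space :: "nat \<Rightarrow> ('a::field \<times> 'a) set set" where
  "proj_space q = proj_vectors q // proj_rel q"

definition conic_points :: "nat \<Rightarrow> 'a::field \<Rightarrow> ('a \<times> 'a) set set" where
  "conic_points q \<Delta> = {P \<in> proj_space q. \<forall>(u, w) \<in> P. Phi q w = \<Delta> * u ^ 2}"

(* On a point with u \<noteq> 0 the image below is a singleton: see root_function_class. *)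
definition root_function :: "('a::field \<times> 'a) set \<Rightarrow> 'a" where
  "root_function P = the_elem ((\<lambda>(u, w). (w - u / 2) / u) ` P)"

definition mult_character :: "('a::field \<Rightarrow> complex) \<Rightarrow> bool" where
  "mult_character \<chi> \<longleftrightarrow> \<chi> 0 = 0 \<and> (\<forall>x. x \<noteq> 0 \<longrightarrow> \<chi> x \<noteq> 0) \<and>
     (\<forall>x y. x \<noteq> 0 \<longrightarrow> y \<noteq> 0 \<longrightarrow> \<chi> (x * y) = \<chi> x * \<chi> y)"

definition trivial_character :: "'a::field \<Rightarrow> complex" where
  "trivial_character x = (if x = 0 then 0 else 1)"

definition character_order :: "('a::field \<Rightarrow> complex) \<Rightarrow> nat" where
  "character_order \<chi> = (LEAST d. d > 0 \<and> (\<lambda>x. \<chi> x ^ d) = trivial_character)"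

definition S_sum :: "nat \<Rightarrow> 'a::field \<Rightarrow> 'a \<Rightarrow> ('a \<Rightarrow> complex) \<Rightarrow> complex" where
  "S_sum q \<mu> \<Delta> \<chi> = (\<Sum>P \<in> conic_points q \<Delta>. \<chi> (\<mu> * root_function P))"

lemma proj_rel_iff:
  "(x, y) \<in> proj_rel q \<longleftrightarrow> x \<in> proj_vectors q \<and> y \<in> proj_vectors q \<and>
     (\<exists>c. c ^ q = c \<and> c \<noteq> 0 \<and> fst y = c * fst x \<and> snd y = c * snd x)"
  by (cases x; cases y) (simp add: proj_rel_def subfield_of_order_def Bex_def conj_assoc)

lemma proj_rel_equiv: "equiv (proj_vectors q :: ('a::field \<times> 'a) set) (proj_rel q)"
proof (rule equivI)
  show "proj_rel q \<subseteq> (proj_vectors q :: ('a \<times> 'a) set) \<times> proj_vectors q"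
    by (simp add: subset_iff proj_rel_iff)
  show "refl_on (proj_vectors q :: ('a \<times> 'a) set) (proj_rel q)"
    by (rule refl_onI) (auto simp: proj_rel_iff intro: exI[of _ 1])
  show "sym (proj_rel q :: (('a \<times> 'a) \<times> ('a \<times> 'a)) set)"
  proof (rule symI)
    fix x y :: "'a \<times> 'a" assume "(x, y) \<in> proj_rel q"
    then obtain c where c: "x \<in> proj_vectors q" "y \<in> proj_vectors q" "c ^ q = c" "c \<noteq> 0"
      "fst y = c * fst x" "snd y = c * snd x"
      unfolding proj_rel_iff by blast
    have "inverse c ^ q = inverse c" "inverse c \<noteq> 0"
      "fst x = inverse c * fst y" "snd x = inverse c * snd y"
      using c by (simp_all add: power_inverse)
    thus "(y, x) \<in> proj_rel q"
      unfolding proj_rel_iff using c(1,2) by (intro conjI exI[of _ "inverse c"])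
  qed
  show "trans (proj_rel q :: (('a \<times> 'a) \<times> ('a \<times> 'a)) set)"
  proof (rule transI)
    fix x y z :: "'a \<times> 'a" assume "(x, y) \<in> proj_rel q" "(y, z) \<in> proj_rel q"
    then obtain c c' where c: "x \<in> proj_vectors q" "z \<in> proj_vectors q" "c ^ q = c" "c \<noteq> 0"
      "c' ^ q = c'" "c' \<noteq> 0" "fst z = c' * (c * fst x)" "snd z = c' * (c * snd x)"
      unfolding proj_rel_iff by metis
    have "(c' * c) ^ q = c' * c" "c' * c \<noteq> 0"
      "fst z = (c' * c) * fst x" "snd z = (c' * c) * snd x"
      using c by (simp_all add: power_mult_distrib)
    thus "(x, z) \<in> proj_rel q"
      unfolding proj_rel_iff using c(1,2) by (intro conjI exI[of _ "c' * c"])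
  qed
qed

lemma root_function_class:
  assumes "P \<in> proj_space q" "(u, w) \<in> P" "u \<noteq> 0"
  shows "root_function P = (w - u / 2) / u"
proof -
  obtain x where x: "P = proj_rel q `` {x}"
    using assms(1) unfolding proj_space_def by (rule quotientE)
  hence "(x, (u, w)) \<in> proj_rel q" using assms(2) by simp
  hence P: "P = proj_rel q `` {(u, w)}"
    using x equiv_class_eq[OF proj_rel_equiv] by blast
  have eq: "(w' - u' / 2) / u' = (w - u / 2) / u" if m: "(u', w') \<in> P" for u' w'
  proof -
    from m obtain c where c: "c \<noteq> 0" "u' = c * u" "w' = c * w"
      unfolding P Image_singleton_iff proj_rel_iff fst_conv snd_conv by blast
    have "(w' - u' / 2) / u' = (c * (w - u / 2)) / (c * u)"
      using c by (simp add: right_diff_distrib)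
    thus ?thesis using c by simp
  qed
  have "(\<lambda>(u, w). (w - u / 2) / u) ` P = {(w - u / 2) / u}" (is "?f ` P = {?b}")
  proof (rule equalityI; rule subsetI)
    fix y assume "y \<in> ?f ` P"
    then obtain u' w' where "(u', w') \<in> P" "y = (w' - u' / 2) / u'" by auto
    thus "y \<in> {?b}" using eq by blast
  next
    fix y assume "y \<in> {?b}"
    hence "y = ?f (u, w)" by simp
    thus "y \<in> ?f ` P" using assms(2) by (rule image_eqI)
  qed
  thus ?thesis by (simp add: root_function_def)
qed

end

theory Submission
  imports Defs "HOL-Computational_Algebra.Computational_Algebra" "HOL-Algebra.Algebraic_Closure_Type"
    "HOL-Number_Theory.Residues"
begin

text \<open>
  The sum is a character sum over the \<open>q + 1\<close> rational points of a conic, hence over a projective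
  line, and the bound is the Riemann hypothesis for the associated L-function together with a
  count of its zeros.

  \<^item> \<^emph>\<open>From the conic to a line.\<close> On the affine conic put \<open>z = w + w^q\<close>. The points become the
    elements \<open>z\<close> with \<open>z^(q+1) = -\<Delta>\<close>, and \<open>2 b = z + \<Delta>/z - 1 = (z - z1)(z - z2)/z\<close>, where
    \<open>z1 + z2 = 1\<close> and \<open>z1 z2 = \<Delta>\<close>. After the choice of one point \<open>z0\<close>, the Moebius map
    \<open>z = z0 (a - \<Delta>)/(a + \<Delta>)\<close> identifies these points with \<open>a\<close> in \<open>\<F>_q\<close> and \<open>a = \<infinity>\<close>, and turns \<open>b\<close>
    into a constant times \<open>(a - \<beta>1)(a - \<beta>2)/(a\<^sup>2 - \<Delta>\<^sup>2)\<close>. The numbers \<open>\<beta>1\<close> and \<open>\<beta>2\<close> lie in \<open>\<F>_{q^4}\<close>,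
    and their eight conjugates over \<open>\<F>_q\<close> are distinct.

  \<^item> \<^emph>\<open>The L-function.\<close> The function \<open>\<Psi>(h) = \<chi>(h(\<beta>1) h(\<beta>2) / (h(\<Delta>) h(-\<Delta>)))\<close> is a multiplicative
    function on \<open>\<F>_q[X]\<close> which does not change when \<open>h\<close> is multiplied by a constant. Its L-function,
    with a factor for the point at infinity, has as \<open>n\<close>-th coefficient the sum of \<open>\<Psi>\<close> over all
    polynomials of degree at most \<open>n\<close> up to scalars. Evaluation at \<open>\<beta>1\<close>, \<open>\<beta>2\<close>, \<open>\<Delta>\<close> maps the
    polynomials of degree at most \<open>9\<close> bijectively to \<open>\<F>_{q^4} \<times> \<F>_{q^4} \<times> \<F>_{q^2}\<close>, so all the
    coefficients of index at least \<open>9\<close> vanish, and the degree is at most \<open>8\<close>. If \<open>\<chi>\<close> is trivial on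
    \<open>\<F>_q\<close>, which is what \<open>d | (q+1)(q\<^sup>2+1)\<close> entails, then the denominator, an element of \<open>\<F>_q\<close> at the
    points of the sum, may be omitted from \<open>\<Psi>\<close>. Evaluation at \<open>\<beta>1\<close> and \<open>\<beta>2\<close> alone then shows that
    the degree is at most \<open>6\<close>. In both cases the sum to be bounded is, up to a factor of modulus at
    most \<open>1\<close>, the linear coefficient, that is, minus the sum of the reciprocal zeros.

  \<^item> \<^emph>\<open>The size of the zeros.\<close> A Newton identity, in place of an Euler product, expresses the power
    sums of the reciprocal zeros by the corresponding character sums over \<open>\<F>_{q^n}\<close>. For \<open>n = 8k\<close> a
    polynomial method in the manner of Stepanov and Bombieri shows that the function under the
    character takes each nonzero value in \<open>\<F>_{q^4}\<close> about equally often, with an error of the order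
    of \<open>q^(n/2)\<close>. So the power sums with these exponents are \<open>O(q^(n/2))\<close>, and every reciprocal zero
    has absolute value at most \<open>sqrt q\<close>.

  All the fields live in one algebraically closed field \<open>'k\<close> of positive characteristic, as fixed
  sets of powers of the Frobenius map; at the end \<open>'k\<close> is an algebraic closure of the given field.
\<close>

hide_const (open) Divisibility.prime Coset.order UnivPoly.coeff UnivPoly.monom

section \<open>Power sums of complex numbers\<close>

text \<open>
  Choose a polynomial \<open>A\<close> that vanishes at all the \<open>z i\<close> different from \<open>z j\<close>. The combination of
  shifted power sums with the coefficients of \<open>A\<close> retains only a nonzero multiple of \<open>z j ^ m\<close>, which
  is therefore \<open>O(R ^ m)\<close>.
\<close>
lemma power_sums_bound_imp_bound:
  fixes z :: "'i \<Rightarrow> complex"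
  assumes "finite I" "j \<in> I" "R > 0"
    and bound: "\<And>m. m \<ge> 1 \<Longrightarrow> norm (\<Sum>i\<in>I. z i ^ m) \<le> C * R ^ m"
  shows "norm (z j) \<le> R"
proof (rule ccontr)
  assume "\<not> norm (z j) \<le> R"
  hence gt: "norm (z j) / R > 1" using \<open>R > 0\<close> by simp
  define A where "A = (\<Prod>w\<in>z ` I - {z j}. [:-w, 1:])"
  define J where "J = {i\<in>I. z i = z j}"
  have fin: "finite (z ` I - {z j})" using assms(1) by auto
  have A_vanish: "poly A (z i) = 0" if "i \<in> I" "z i \<noteq> z j" for i
    unfolding A_def poly_prod using fin that by (intro prod_zero) auto
  have A_nz: "poly A (z j) \<noteq> 0"
    unfolding A_def poly_prod using fin by (auto simp: prod_zero_iff)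
  have "finite J" "J \<noteq> {}" using assms unfolding J_def by auto
  hence cJ: "card J > 0" by (simp add: card_gt_0_iff)
  define c where "c = card J * norm (poly A (z j))"
  have c: "c > 0" unfolding c_def using cJ A_nz by simp
  define C' where "C' = (\<Sum>k\<le>degree A. norm (coeff A k) * (C * R ^ k))"
  have key: "c * (norm (z j) / R) ^ m \<le> C'" if "m \<ge> 1" for m
  proof -
    have "(\<Sum>k\<le>degree A. coeff A k * (\<Sum>i\<in>I. z i ^ (m + k))) = (\<Sum>i\<in>I. z i ^ m * poly A (z i))"
      unfolding poly_altdef sum_distrib_left
      by (subst sum.swap) (simp add: power_add mult_ac)
    also have "\<dots> = (\<Sum>i\<in>J. z i ^ m * poly A (z i))"
      unfolding J_def using assms(1) A_vanish by (intro sum.mono_neutral_right) auto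
    also have "\<dots> = (\<Sum>i\<in>J. z j ^ m * poly A (z j))"
      unfolding J_def by (intro sum.cong) auto
    also have "\<dots> = of_nat (card J) * (z j ^ m * poly A (z j))" by simp
    finally have "c * norm (z j) ^ m = norm (\<Sum>k\<le>degree A. coeff A k * (\<Sum>i\<in>I. z i ^ (m + k)))"
      by (simp add: c_def norm_mult norm_power)
    also have "\<dots> \<le> (\<Sum>k\<le>degree A. norm (coeff A k) * (C * R ^ (m + k)))"
      by (intro sum_norm_le) (auto simp: norm_mult intro!: mult_left_mono bound that trans_le_add1)
    also have "\<dots> = C' * R ^ m"
      unfolding C'_def sum_distrib_right by (simp add: power_add mult_ac)
    finally show ?thesis using \<open>R > 0\<close> by (simp add: power_divide field_simps)
  qed
  obtain m where m: "C' / c < (norm (z j) / R) ^ m"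
    using real_arch_pow[OF gt] by blast
  have "(norm (z j) / R) ^ m \<le> (norm (z j) / R) ^ Suc m"
    using gt by (intro power_increasing) auto
  with m have "C' / c < (norm (z j) / R) ^ Suc m" by linarith
  hence "C' < c * (norm (z j) / R) ^ Suc m"
    using c by (simp add: field_simps)
  with key[of "Suc m"] show False by simp
qed

text \<open>
  The \<open>w\<close> are the reciprocal zeros: \<open>p = \<Prod>(1 - w X)\<close>. The logarithmic derivative turns this product
  into a sum of geometric series.
\<close>
lemma log_derivative_factorization:
  fixes p :: "complex poly"
  assumes "coeff p 0 = 1"
  shows "\<exists>ws. length ws = degree p \<and> coeff p 1 = - sum_list ws \<and>
    fps_X * fps_deriv (fps_of_poly p) =
      fps_of_poly p * Abs_fps (\<lambda>n. if n = 0 then 0 else - (\<Sum>w\<leftarrow>ws. w ^ n))"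
  using assms
proof (induction "degree p" arbitrary: p)
  case 0
  then obtain c where "p = [:c:]" by (metis degree_eq_zeroE)
  with 0 have "p = 1" by (simp add: one_pCons)
  thus ?case by (intro exI[of _ "[]"]) (auto simp: fps_eq_iff)
next
  case (Suc n)
  have "\<exists>x. poly p x = 0" using Suc.hyps(2) by (intro alg_closed_imp_poly_has_root) auto
  then obtain x where x: "poly p x = 0" by blast
  have "x \<noteq> 0" using x Suc.prems by (auto simp: poly_0_coeff_0)
  define w where "w = 1 / x"
  have "[:-x, 1:] dvd p" using x by (simp add: poly_eq_0_iff_dvd)
  then obtain s where s: "p = [:-x, 1:] * s" by (elim dvdE)
  define r where "r = smult (-x) s"
  have "[:-x, 1:] = smult (-x) [:1, -w:]" using \<open>x \<noteq> 0\<close> by (simp add: w_def)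
  hence p: "p = [:1, -w:] * r"
    by (simp only: s r_def mult_smult_left mult_smult_right)
  have r0: "coeff r 0 = 1" using Suc.prems by (simp add: p)
  have "w \<noteq> 0" using \<open>x \<noteq> 0\<close> by (simp add: w_def)
  have "r \<noteq> 0" using r0 by auto
  have "degree p = Suc (degree r)"
    unfolding p using \<open>r \<noteq> 0\<close> \<open>w \<noteq> 0\<close> by (subst degree_mult_eq) auto
  with Suc.hyps(2) have "n = degree r" by simp
  from Suc.hyps(1)[OF this r0] obtain ws where
    ws: "length ws = degree r" "coeff r 1 = - sum_list ws"
     "fps_X * fps_deriv (fps_of_poly r) =
        fps_of_poly r * Abs_fps (\<lambda>n. if n = 0 then 0 else - (\<Sum>w\<leftarrow>ws. w ^ n))" (is "_ = _ * ?S") by auto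
  define u :: "complex fps" where "u = fps_of_poly [:1, -w:]"
  define T where "T = Abs_fps (\<lambda>n. if n = 0 then 0 else - (w ^ n))"
  have u: "u = 1 - fps_const w * fps_X"
    by (simp add: u_def fps_of_poly_pCons)
  have uT: "fps_X * fps_deriv u = u * T"
  proof (rule fps_ext)
    fix m
    have "u * T = T - fps_const w * (fps_X * T)" unfolding u by (simp add: left_diff_distrib mult.assoc)
    moreover have "fps_deriv u = - fps_const w" unfolding u by simp
    ultimately show "(fps_X * fps_deriv u) $ m = (u * T) $ m"
      by (cases m) (auto simp: T_def)
  qed
  have fp: "fps_of_poly p = u * fps_of_poly r" by (simp only: p fps_of_poly_mult u_def)
  have "fps_X * fps_deriv (fps_of_poly p) = (fps_X * fps_deriv u) * fps_of_poly r + u * (fps_X * fps_deriv (fps_of_poly r))"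
    unfolding fp by (simp add: algebra_simps)
  also have "\<dots> = fps_of_poly p * (T + ?S)"
    unfolding uT ws(3) fp by (simp only: algebra_simps)
  also have "T + ?S = Abs_fps (\<lambda>n. if n = 0 then 0 else - (\<Sum>v\<leftarrow>w # ws. v ^ n))"
    by (rule fps_ext) (simp add: T_def)
  finally have "fps_X * fps_deriv (fps_of_poly p) = fps_of_poly p * Abs_fps (\<lambda>n. if n = 0 then 0 else - (\<Sum>v\<leftarrow>w # ws. v ^ n))" .
  moreover have "coeff p 1 = - sum_list (w # ws)"
    using ws(2) r0 by (simp add: p coeff_pCons)
  ultimately show ?case using ws(1) \<open>degree p = Suc (degree r)\<close>
    by (intro exI[of _ "w # ws"]) auto
qed

text \<open>
  A bound for the coefficients of the logarithmic derivative along the multiples of one \<open>N\<close> is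
  enough, because these are the power sums of the \<open>N\<close>-th powers of the reciprocal zeros.
\<close>
lemma linear_coeff_bound_of_power_sum_bound:
  fixes p :: "complex poly" and S :: "complex fps" and r :: real
  assumes p0: "coeff p 0 = 1"
    and log: "fps_X * fps_deriv (fps_of_poly p) = fps_of_poly p * S"
    and N: "N > 0" and r: "r > 0"
    and bound: "\<And>m. m \<ge> 1 \<Longrightarrow> norm (S $ (N * m)) \<le> C * (r ^ N) ^ m"
  shows "norm (coeff p 1) \<le> degree p * r"
proof -
  obtain ws where ws: "length ws = degree p" "coeff p 1 = - sum_list ws"
    "fps_X * fps_deriv (fps_of_poly p) =
      fps_of_poly p * Abs_fps (\<lambda>n. if n = 0 then 0 else - (\<Sum>w\<leftarrow>ws. w ^ n))" (is "_ = _ * ?S")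
    using log_derivative_factorization[OF p0] by blast
  have "fps_of_poly p \<noteq> 0" using p0 by (metis fps_of_poly_nth fps_zero_nth zero_neq_one)
  hence S: "S = ?S" using log ws(3) by (metis mult_left_cancel)
  have le: "norm (ws ! j) \<le> r" if j: "j < length ws" for j
  proof -
    have "norm ((ws ! j) ^ N) \<le> r ^ N"
    proof (rule power_sums_bound_imp_bound[of "{..<length ws}" j _ "\<lambda>i. (ws ! i) ^ N" C])
      fix m :: nat assume m: "m \<ge> 1"
      have "norm (\<Sum>i<length ws. ((ws ! i) ^ N) ^ m) = norm (S $ (N * m))"
        using m N by (simp add: S sum_list_sum_nth atLeast0LessThan power_mult)
      thus "norm (\<Sum>i<length ws. ((ws ! i) ^ N) ^ m) \<le> C * (r ^ N) ^ m"
        using bound[OF m] by simp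
    qed (use j r in auto)
    hence "norm (ws ! j) ^ N \<le> r ^ N" by (simp add: norm_power)
    thus ?thesis using N r by (simp add: power_mono_iff)
  qed
  have "norm (coeff p 1) = norm (\<Sum>i<length ws. ws ! i)"
    by (simp only: ws(2) sum_list_sum_nth atLeast0LessThan norm_minus_cancel)
  also have "\<dots> \<le> (\<Sum>i<length ws. r)"
    by (intro sum_norm_le) (use le in auto)
  finally show ?thesis by (simp add: ws(1))
qed

section \<open>Level sets of polynomials over finite fields\<close>

lemma homogeneous_system_nontrivial_solution:
  fixes c :: "'v \<Rightarrow> 'u \<Rightarrow> 'k::field"
  assumes "finite V" "finite U" "card V < card U"
  shows "\<exists>x. (\<exists>u\<in>U. x u \<noteq> 0) \<and> (\<forall>v\<in>V. (\<Sum>u\<in>U. c v u * x u) = 0)"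
  using assms
proof (induction V arbitrary: U c rule: finite_induct)
  case empty
  hence "U \<noteq> {}" by auto
  thus ?case by (intro exI[of _ "\<lambda>_. 1"]) auto
next
  case (insert v V)
  show ?case
  proof (cases "\<forall>u\<in>U. c v u = 0")
    case True
    from insert.prems insert.hyps have "card V < card U" by simp
    from insert.IH[OF insert.prems(1) this, of c] True show ?thesis by auto
  next
    case False
    then obtain w where w: "w \<in> U" "c v w \<noteq> 0" by auto
    define c' where "c' = (\<lambda>i u. c i u - c i w * c v u / c v w)"
    have "card V < card (U - {w})" using insert.prems insert.hyps w by simp
    then obtain x where x: "\<exists>u\<in>U - {w}. x u \<noteq> 0" "\<And>i. i \<in> V \<Longrightarrow> (\<Sum>u\<in>U - {w}. c' i u * x u) = 0"
      using insert.IH[of "U - {w}" c'] insert.prems(1) by auto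
    define s where "s = (\<Sum>u\<in>U - {w}. c v u * x u)"
    define y where "y = x(w := - s / c v w)"
    have split: "(\<Sum>u\<in>U. c i u * y u) = (\<Sum>u\<in>U - {w}. c i u * x u) - c i w * s / c v w" for i
    proof -
      have "(\<Sum>u\<in>U. c i u * y u) = c i w * y w + (\<Sum>u\<in>U - {w}. c i u * y u)"
        using insert.prems(1) w by (intro sum.remove) auto
      also have "(\<Sum>u\<in>U - {w}. c i u * y u) = (\<Sum>u\<in>U - {w}. c i u * x u)"
        by (intro sum.cong) (auto simp: y_def)
      finally show ?thesis by (simp add: y_def)
    qed
    have "(\<Sum>u\<in>U. c i u * y u) = 0" if "i \<in> V" for i
    proof -
      have "(\<Sum>u\<in>U - {w}. c' i u * x u) = (\<Sum>u\<in>U - {w}. c i u * x u) - c i w * s / c v w"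
        unfolding c'_def s_def left_diff_distrib sum_subtractf sum_distrib_left sum_divide_distrib
        by (simp add: mult_ac)
      with split x(2)[OF that] show ?thesis by simp
    qed
    moreover have "(\<Sum>u\<in>U. c v u * y u) = 0"
      using split[of v] w by (simp add: s_def)
    moreover have "\<exists>u\<in>U. y u \<noteq> 0" using x(1) by (auto simp: y_def)
    ultimately show ?thesis by (intro exI[of _ y]) auto
  qed
qed

lemma polynomials_linearly_dependent:
  fixes P :: "'u \<Rightarrow> 'k::field poly"
  assumes "finite U" "n < card U" "\<And>u. u \<in> U \<Longrightarrow> degree (P u) < n"
  shows "\<exists>a. (\<exists>u\<in>U. a u \<noteq> 0) \<and> (\<Sum>u\<in>U. smult (a u) (P u)) = 0"
proof -
  obtain a where a: "\<exists>u\<in>U. a u \<noteq> 0" "\<And>k. k < n \<Longrightarrow> (\<Sum>u\<in>U. coeff (P u) k * a u) = 0"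
    using homogeneous_system_nontrivial_solution[of "{..<n}" U "\<lambda>k u. coeff (P u) k"] assms(1,2)
    by auto
  have "(\<Sum>u\<in>U. smult (a u) (P u)) = 0"
  proof (rule poly_eqI)
    fix k
    show "coeff (\<Sum>u\<in>U. smult (a u) (P u)) k = coeff 0 k"
    proof (cases "k < n")
      case True
      thus ?thesis using a(2)[OF True] by (simp add: coeff_sum mult_ac)
    next
      case False
      have "coeff (P u) k = 0" if "u \<in> U" for u
        using assms(3)[OF that] False by (intro coeff_eq_0) auto
      thus ?thesis by (simp add: coeff_sum)
    qed
  qed
  with a(1) show ?thesis by blast
qed

text \<open>
  The digits are \<open>i\<close>, \<open>j\<close> and \<open>b\<close>, with place values \<open>R\<close>, \<open>e\<close> and \<open>1\<close>.
\<close>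
lemma mixed_radix_inj:
  fixes d e R :: nat
  assumes "d * e < R" "j < d" "b < e" "j' < d" "b' < e" "b + i * R + j * e = b' + i' * R + j' * e"
  shows "i = i' \<and> j = j' \<and> b = b'"
proof -
  have lt: "b + j * e < R" if "j < d" "b < e" for j b
  proof -
    have "b + j * e < e + j * e" using that by simp
    also have "\<dots> = Suc j * e" by simp
    also have "\<dots> \<le> d * e" using that by (intro mult_right_mono) auto
    finally show ?thesis using assms(1) by simp
  qed
  have eq: "(b + j * e) + i * R = (b' + j' * e) + i' * R" using assms(6) by simp
  have "((b + j * e) + i * R) mod R = ((b' + j' * e) + i' * R) mod R" using eq by simp
  hence r: "b + j * e = b' + j' * e"
    using lt[OF assms(2,3)] lt[OF assms(4,5)] by simp
  hence "i * R = i' * R" using eq by simp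
  hence "i = i'" using assms(1) by simp
  moreover have "(b + j * e) mod e = (b' + j' * e) mod e" using r by simp
  hence "b = b'" using assms by simp
  moreover have "j = j'" using r \<open>b = b'\<close> assms by simp
  ultimately show ?thesis by simp
qed

text \<open>
  The summand with index \<open>(i, j, b)\<close> is divisible by \<open>X\<close> to the power \<open>b + i R + j e\<close> and no further,
  since \<open>H(0) \<noteq> 0\<close>. These exponents are pairwise distinct, so the lowest one that occurs with a
  nonzero coefficient survives in the sum.
\<close>
lemma stepanov_combination_nonzero:
  fixes c :: "nat \<times> nat \<times> nat \<Rightarrow> 'k::field" and H :: "'k poly"
  assumes "poly H 0 \<noteq> 0" "d * e < R" "finite U" "U \<subseteq> UNIV \<times> {..<d} \<times> {..<e}" "\<exists>u\<in>U. c u \<noteq> 0"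
  shows "(\<Sum>(i, j, b)\<in>U. smult (c (i, j, b)) (monom 1 (b + i * R) * (([:0, 1:] * H) ^ e) ^ j)) \<noteq> 0"
proof -
  define N where "N = (\<lambda>(i, j, b). b + i * R + j * e)"
  have inj: "inj_on N U"
  proof (rule inj_onI)
    fix u u' assume u: "u \<in> U" "u' \<in> U" "N u = N u'"
    obtain i j b where [simp]: "u = (i, j, b)" by (cases u) auto
    obtain i' j' b' where [simp]: "u' = (i', j', b')" by (cases u') auto
    have "j < d" "b < e" "j' < d" "b' < e" using u(1,2) assms(4) by auto
    from mixed_radix_inj[OF assms(2) this] u(3) show "u = u'" by (auto simp: N_def)
  qed
  define T where "T = (\<lambda>(i, j, b). smult (c (i, j, b)) (monom 1 (N (i, j, b)) * H ^ (e * j)))"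
  have T: "(\<Sum>(i, j, b)\<in>U. smult (c (i, j, b)) (monom 1 (b + i * R) * (([:0, 1:] * H) ^ e) ^ j)) = (\<Sum>u\<in>U. T u)"
  proof (intro sum.cong refl, clarify)
    fix i j b
    have "(([:0, 1:] * H) ^ e) ^ j = [:0, 1:] ^ (e * j) * H ^ (e * j)"
      by (simp only: power_mult[symmetric] power_mult_distrib)
    also have "[:0, 1:] ^ (e * j) = monom (1::'k) (j * e)"
      by (simp add: monom_altdef mult.commute)
    finally have "(([:0, 1:] * H) ^ e) ^ j = monom 1 (j * e) * H ^ (e * j)" .
    thus "smult (c (i, j, b)) (monom 1 (b + i * R) * (([:0, 1:] * H) ^ e) ^ j) = T (i, j, b)"
      by (simp only: T_def N_def prod.case mult.assoc[symmetric] mult_monom mult_1_left)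
  qed
  define W where "W = {u\<in>U. c u \<noteq> 0}"
  have "finite W" "W \<noteq> {}" using assms by (auto simp: W_def)
  then obtain u where u: "u \<in> W" "\<And>w. w \<in> W \<Longrightarrow> N u \<le> N w"
    by (metis arg_min_if_finite(1) arg_min_least)
  have others: "coeff (T w) (N u) = 0" if w: "w \<in> U" "w \<noteq> u" for w
  proof (cases "c w = 0")
    case False
    hence "N u \<le> N w" using u(2) w by (auto simp: W_def)
    moreover have "N u \<noteq> N w" using inj w u(1) unfolding inj_on_def W_def by blast
    ultimately show ?thesis
      by (auto simp: T_def coeff_monom_mult split: prod.splits)
  qed (auto simp: T_def split: prod.splits)
  have "coeff (\<Sum>u\<in>U. T u) (N u) = (\<Sum>w\<in>U. if w = u then coeff (T u) (N u) else 0)"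
    unfolding coeff_sum using others by (intro sum.cong) auto
  also have "\<dots> = coeff (T u) (N u)" using u(1) assms(3) by (auto simp: W_def)
  also have "\<dots> = c u * poly H 0 ^ (e * fst (snd u))"
    by (cases u) (simp add: T_def coeff_monom_mult poly_0_coeff_0 coeff_0_power)
  also have "\<dots> \<noteq> 0" using u(1) assms(1) by (simp add: W_def)
  finally show ?thesis unfolding T by auto
qed

text \<open>
  This is Stepanov's method in Bombieri's form. Let \<open>v = (X H)^e\<close>. On the level set \<open>x^(R\<^sup>2) = x\<close> and
  \<open>v^R v = \<omega>\<close>, so the \<open>R\<close>-th power of \<open>\<Phi> = \<Sum> c_ijb X^(b + i R) v^j\<close> agrees there, up to the unit
  \<open>v^(d-1)\<close>, with \<open>\<Sum> c_ijb^R \<omega>^j X^(b R + i) v^(d-1-j)\<close>. The degree of the latter is so small that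
  linear algebra provides coefficients, not all zero, for which it vanishes identically. Then \<open>\<Phi>\<close> is a
  nonzero polynomial of degree about \<open>e R\<close> which vanishes on the level set. Passing to \<open>R\<close>-th powers
  does what vanishing to high order does in Stepanov's original argument, without derivatives.
\<close>
lemma level_set_bound_at_zero:
  fixes H :: "'k::alg_closed_field poly" and d e R g :: nat
  assumes "prime CHAR('k)" and R: "R = CHAR('k) ^ k" and de: "R = d * e + 1" and "d \<ge> 2" "e \<ge> 1"
    and H: "poly H 0 \<noteq> 0" and g: "g = degree H + 1" and \<omega>: "\<omega> \<noteq> 0"
  shows "card {x. x ^ (R\<^sup>2) = x \<and> poly ([:0, 1:] * H) x ^ (e * (R + 1)) = \<omega>} \<le> e * R + 2 * g * R"
proof -
  define A where "A = {x. x ^ (R\<^sup>2) = x \<and> poly ([:0, 1:] * H) x ^ (e * (R + 1)) = \<omega>}"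
  define v where "v = ([:0, 1:] * H) ^ e"
  have "H \<noteq> 0" using H by auto
  have degG: "degree ([:0, 1:] * H) = g"
    using \<open>H \<noteq> 0\<close> by (subst degree_mult_eq) (auto simp: g)
  have degv: "degree (v ^ j) = j * (e * g)" for j
  proof -
    have "[:0, 1:] * H \<noteq> 0" using \<open>H \<noteq> 0\<close> by simp
    from degree_power_eq[OF this, of "e * j", unfolded degG] show ?thesis
      unfolding v_def power_mult[symmetric] by (simp only: mult_ac)
  qed
  (* With e + g values of i the number (e + g) d e of unknowns just exceeds the bound n on degrees. *)
  define U where "U = {..<e + g} \<times> {..<d} \<times> {..<e}"
  define P where "P = (\<lambda>(i, j, b). monom (\<omega> ^ j) (b * R + i) * v ^ (d - 1 - j))"
  define n where "n = (e - 1) * R + (e + g) + (d - 1) * (e * g)"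
  obtain d' where d': "d = Suc (Suc d')" using \<open>d \<ge> 2\<close> by (metis add_2_eq_Suc le_Suc_ex)
  obtain e' where e': "e = Suc e'" using \<open>e \<ge> 1\<close> by (metis Suc_le_D One_nat_def)
  have "finite U" by (simp add: U_def)
  have "n < card U"
    by (simp add: U_def card_cartesian_product n_def de d' e' algebra_simps)
  moreover have "degree (P u) < n" if u: "u \<in> U" for u
  proof -
    obtain i j b where [simp]: "u = (i, j, b)" by (cases u) auto
    have ijb: "i < e + g" "j < d" "b < e" using u by (auto simp: U_def)
    have "degree (P u) \<le> (b * R + i) + (d - 1 - j) * (e * g)"
      unfolding P_def using degree_mult_le[of "monom (\<omega> ^ j) (b * R + i)" "v ^ (d - 1 - j)"]
        degree_monom_le[of "\<omega> ^ j" "b * R + i"] degv[of "d - 1 - j"] by simp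
    also have "\<dots> \<le> ((e - 1) * R + i) + (d - 1) * (e * g)"
      using ijb by (intro add_mono mult_right_mono) auto
    also have "\<dots> < n" unfolding n_def using ijb by simp
    finally show ?thesis .
  qed
  ultimately obtain a where a: "\<exists>u\<in>U. a u \<noteq> 0" "(\<Sum>u\<in>U. smult (a u) (P u)) = 0"
    using polynomials_linearly_dependent[OF \<open>finite U\<close>] by metis
  have "R > 0" using de by simp
  (* The field is perfect, and the solution a of the linear system is replaced by its R-th roots. *)
  have "\<forall>u. \<exists>y. y ^ R = a u"
    using nth_root_exists[OF \<open>R > 0\<close>] by blast
  hence "\<exists>c. \<forall>u. c u ^ R = a u" by (rule choice)
  then obtain c where c: "\<And>u. c u ^ R = a u" by blast
  define \<Phi> where "\<Phi> = (\<Sum>(i, j, b)\<in>U. smult (c (i, j, b)) (monom 1 (b + i * R) * v ^ j))"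
  have "\<exists>u\<in>U. c u \<noteq> 0" using a(1) c \<open>R > 0\<close> by (metis power_0_left not_gr_zero)
  hence "\<Phi> \<noteq> 0" unfolding \<Phi>_def v_def
    using de by (intro stepanov_combination_nonzero[OF H _ \<open>finite U\<close>]) (auto simp: U_def)
  have "poly \<Phi> x = 0" if x: "x \<in> A" for x
  proof -
    have xR: "x ^ (R * R) = x" using x by (simp add: A_def power2_eq_square)
    define V where "V = poly v x"
    have V: "V ^ (R + 1) = \<omega>"
      using x unfolding A_def V_def v_def poly_power mem_Collect_eq power_mult by simp
    hence "V \<noteq> 0" using \<omega> by auto
    have "poly \<Phi> x ^ R = (\<Sum>(i, j, b)\<in>U. c (i, j, b) * (x ^ (b + i * R) * V ^ j)) ^ R"
      unfolding \<Phi>_def poly_sum V_def by (simp add: case_prod_beta poly_monom poly_power)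
    also have "\<dots> = (\<Sum>(i, j, b)\<in>U. (c (i, j, b) * (x ^ (b + i * R) * V ^ j)) ^ R)"
      by (subst freshmans_dream_sum'[OF assms(1) R]) (simp add: case_prod_beta)
    finally have "poly \<Phi> x ^ R * V ^ (d - 1) =
       (\<Sum>(i, j, b)\<in>U. (c (i, j, b) * (x ^ (b + i * R) * V ^ j)) ^ R * V ^ (d - 1))"
      by (simp add: sum_distrib_right case_prod_beta)
    also have "\<dots> = (\<Sum>u\<in>U. poly (smult (a u) (P u)) x)"
    proof (intro sum.cong refl, clarify)
      fix i j b assume "(i, j, b) \<in> U"
      hence j: "j < d" by (simp add: U_def)
      have "x ^ (i * R * R) = x ^ i" using xR by (metis mult.assoc mult.commute power_mult)
      hence X: "x ^ ((b + i * R) * R) = x ^ (b * R + i)" by (simp add: distrib_right power_add)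
      have "V ^ (j * R) * V ^ (d - 1) = V ^ (j * R) * (V ^ j * V ^ (d - 1 - j))"
        using j by (simp flip: power_add)
      also have "\<dots> = (V ^ (R + 1)) ^ j * V ^ (d - 1 - j)"
        by (simp add: power_mult[symmetric] power_add algebra_simps power_mult_distrib)
      finally have VV: "V ^ (j * R) * V ^ (d - 1) = \<omega> ^ j * V ^ (d - 1 - j)" by (simp only: V)
      have "(c (i, j, b) * (x ^ (b + i * R) * V ^ j)) ^ R * V ^ (d - 1)
          = a (i, j, b) * (x ^ ((b + i * R) * R) * (V ^ (j * R) * V ^ (d - 1)))"
        by (simp add: power_mult_distrib c power_mult[symmetric] mult.assoc)
      also have "\<dots> = poly (smult (a (i, j, b)) (P (i, j, b))) x"
        unfolding X VV by (simp add: P_def poly_monom poly_power V_def mult_ac)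
      finally show "(c (i, j, b) * (x ^ (b + i * R) * V ^ j)) ^ R * V ^ (d - 1) = poly (smult (a (i, j, b)) (P (i, j, b))) x" .
    qed
    also have "\<dots> = poly (\<Sum>u\<in>U. smult (a u) (P u)) x" by (simp add: poly_sum)
    also have "\<dots> = 0" by (simp add: a(2))
    finally show ?thesis using \<open>V \<noteq> 0\<close> \<open>R > 0\<close> by simp
  qed
  hence "A \<subseteq> {x. poly \<Phi> x = 0}" by auto
  hence "card A \<le> card {x. poly \<Phi> x = 0}"
    using poly_roots_finite[OF \<open>\<Phi> \<noteq> 0\<close>] by (intro card_mono)
  also have "\<dots> \<le> degree \<Phi>" using card_poly_roots_bound[OF \<open>\<Phi> \<noteq> 0\<close>] .
  also have "degree \<Phi> \<le> (e - 1) + (e + g - 1) * R + (d - 1) * (e * g)"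
    unfolding \<Phi>_def
  proof (intro degree_sum_le \<open>finite U\<close>, clarify)
    fix i j b assume "(i, j, b) \<in> U"
    hence ijb: "i \<le> e + g - 1" "j \<le> d - 1" "b \<le> e - 1" by (auto simp: U_def)
    have "degree (smult (c (i, j, b)) (monom 1 (b + i * R) * v ^ j)) \<le> degree (monom (1::'k) (b + i * R) * v ^ j)"
      by (rule degree_smult_le)
    also have "\<dots> \<le> b + i * R + j * (e * g)"
      using degree_mult_le[of "monom (1::'k) (b + i * R)" "v ^ j"] degv[of j]
      by (simp add: degree_monom_eq)
    also have "\<dots> \<le> (e - 1) + (e + g - 1) * R + (d - 1) * (e * g)"
      using ijb by (intro add_mono mult_right_mono) auto
    finally show "degree (smult (c (i, j, b)) (monom 1 (b + i * R) * v ^ j)) \<le>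
      (e - 1) + (e + g - 1) * R + (d - 1) * (e * g)" .
  qed
  also have "\<dots> \<le> e * R + 2 * g * R"
  proof -
    have "(e - 1) + (e + g - 1) * R \<le> e * R + g * R"
      by (simp add: e' de d' algebra_simps)
    moreover have "(d - 1) * (e * g) \<le> g * R"
      by (simp add: de d' algebra_simps)
    ultimately show ?thesis by (simp add: algebra_simps)
  qed
  finally show ?thesis unfolding A_def .
qed

text \<open>
  Translation by \<open>\<gamma>\<close> preserves the fixed field of \<open>x \<mapsto> x^(R\<^sup>2)\<close>, so the simple zero may be moved to the
  origin.
\<close>
lemma level_set_bound:
  fixes H :: "'k::alg_closed_field poly" and d e R g :: nat and \<gamma> :: 'k
  assumes "prime CHAR('k)" and R: "R = CHAR('k) ^ k" and de: "R = d * e + 1" and "d \<ge> 2" "e \<ge> 1"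
    and H: "poly H \<gamma> \<noteq> 0" and g: "g = degree H + 1" and \<omega>: "\<omega> \<noteq> 0" and \<gamma>: "\<gamma> ^ (R\<^sup>2) = \<gamma>"
  shows "card {x. x ^ (R\<^sup>2) = x \<and> poly ([:- \<gamma>, 1:] * H) x ^ (e * (R + 1)) = \<omega>} \<le> e * R + 2 * g * R"
proof -
  define H' where "H' = H \<circ>\<^sub>p [:\<gamma>, 1:]"
  have dR: "R\<^sup>2 = CHAR('k) ^ (k * 2)" using R by (simp add: power_mult)
  have add: "(x + y) ^ (R\<^sup>2) = x ^ (R\<^sup>2) + y ^ (R\<^sup>2)" for x y :: 'k
    by (rule freshmans_dream'[OF assms(1) dR])
  have "bij_betw (\<lambda>x. x + \<gamma>) {x. x ^ (R\<^sup>2) = x \<and> poly ([:0, 1:] * H') x ^ (e * (R + 1)) = \<omega>}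
     {x. x ^ (R\<^sup>2) = x \<and> poly ([:- \<gamma>, 1:] * H) x ^ (e * (R + 1)) = \<omega>}" (is "bij_betw _ ?A ?B")
  proof (rule bij_betwI[where g = "\<lambda>x. x - \<gamma>"])
    have "(x - \<gamma>) ^ (R\<^sup>2) = x ^ (R\<^sup>2) - \<gamma>" for x :: 'k
      using add[of "x - \<gamma>" \<gamma>] \<gamma> by simp
    thus "(\<lambda>x. x - \<gamma>) \<in> ?B \<rightarrow> ?A" by (auto simp: H'_def poly_pcompose left_diff_distrib)
    have "poly ([:- \<gamma>, 1:] * H) (x + \<gamma>) = poly ([:0, 1:] * H') x" for x
      by (simp add: H'_def poly_pcompose add_ac del: mult_pCons_left)
    thus "(\<lambda>x. x + \<gamma>) \<in> ?A \<rightarrow> ?B" by (auto simp only: add \<gamma> mem_Collect_eq)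
  qed auto
  hence "card ?B = card ?A" by (simp add: bij_betw_same_card)
  also have "\<dots> \<le> e * R + 2 * g * R"
    by (rule level_set_bound_at_zero[OF assms(1-5)])
       (use H \<omega> in \<open>auto simp: H'_def g poly_pcompose degree_pcompose\<close>)
  finally show ?thesis .
qed

section \<open>Finite subfields of an algebraically closed field\<close>

lemma degree_eq_sum_order:
  fixes p :: "'k::alg_closed_field poly"
  assumes "p \<noteq> 0"
  shows "degree p = (\<Sum>x | poly p x = 0. order x p)"
proof -
  obtain A where A: "size A = degree p" "p = smult (lead_coeff p) (\<Prod>x\<in>#A. [:-x, 1:])"
    using alg_closed_imp_factorization[OF assms] by blast
  have "proots p = proots (\<Prod>x\<in>#A. [:-x, 1:])"
    by (subst A(2)) (use assms in simp)
  also have "\<dots> = A"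
  proof (induction A)
    case (add x A)
    have "(\<Prod>x\<in>#A. [:-x, 1:]) \<noteq> 0" by (auto simp: prod_mset_zero_iff)
    with add have "proots ([:- x, 1:] * (\<Prod>x\<in>#A. [:-x, 1:])) = {#x#} + A"
      by (subst proots_mult) auto
    thus ?case by simp
  qed simp
  finally have "degree p = size (proots p)" using A(1) by simp
  also have "\<dots> = (\<Sum>x | poly p x = 0. order x p)"
    using assms by (simp add: size_multiset_overloaded_eq)
  finally show ?thesis .
qed

lemma prod_linear_dvd:
  fixes h :: "'k::field poly"
  assumes "finite S" "\<And>x. x \<in> S \<Longrightarrow> poly h x = 0"
  shows "(\<Prod>x\<in>S. [:-x, 1:]) dvd h"
  using assms
proof (induction S arbitrary: h rule: finite_induct)
  case (insert y S)
  have "[:-y, 1:] dvd h" using insert.prems by (simp add: poly_eq_0_iff_dvd)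
  then obtain g where g: "h = [:-y, 1:] * g" by (elim dvdE)
  have "poly g x = 0" if "x \<in> S" for x
  proof -
    have "poly h x = 0" "x \<noteq> y" using that insert by auto
    thus ?thesis by (auto simp: g)
  qed
  hence "(\<Prod>x\<in>S. [:-x, 1:]) dvd g" by (rule insert.IH)
  thus ?case unfolding g prod.insert[OF insert.hyps] by (rule mult_dvd_mono[OF dvd_refl])
qed auto

text \<open>
  All finite fields of the proof are subsets of the field \<open>'k\<close>, so that extensions of every degree are
  available at once. The parameter \<open>ty\<close> names this type.
\<close>
locale frobenius =
  fixes q :: nat and ty :: "'k::alg_closed_field itself"
  assumes prime_char: "prime CHAR('k)" and q_char_power: "\<exists>s>0. q = CHAR('k) ^ s"
begin

lemma q_gt_1: "q > 1"
  using q_char_power one_less_power[OF prime_gt_1_nat[OF prime_char]] by blast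

lemma q_pos [simp]: "q > 0" "q \<noteq> 0"
  using q_gt_1 by simp_all

lemma frob_sum: "(sum f A :: 'k) ^ (q ^ j) = (\<Sum>i\<in>A. f i ^ (q ^ j))"
proof -
  obtain s where "q = CHAR('k) ^ s" using q_char_power by blast
  hence "q ^ j = CHAR('k) ^ (s * j)" by (simp add: power_mult)
  from freshmans_dream_sum'[OF prime_char this] show ?thesis .
qed

lemma frob_add: "(x + y :: 'k) ^ (q ^ j) = x ^ (q ^ j) + y ^ (q ^ j)"
  using frob_sum[of "\<lambda>b. if b then x else y" "{True, False}" j] by simp

lemma frob_minus: "(- x :: 'k) ^ (q ^ j) = - (x ^ (q ^ j))"
  using frob_add[of x "- x" j] by (simp add: eq_neg_iff_add_eq_0 add.commute power_0_left)

lemma frob_diff: "(x - y :: 'k) ^ (q ^ j) = x ^ (q ^ j) - y ^ (q ^ j)"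
  using frob_add[of x "- y" j] by (simp add: frob_minus)

lemma frob_inj: "(x :: 'k) ^ (q ^ j) = y ^ (q ^ j) \<longleftrightarrow> x = y"
  using frob_diff[of x y j] by auto

lemmas frob_sum1 = frob_sum[of _ _ 1, simplified]
  and frob_add1 = frob_add[of _ _ 1, simplified]
  and frob_minus1 = frob_minus[of _ 1, simplified]
  and frob_diff1 = frob_diff[of _ _ 1, simplified]
  and frob_inj1 = frob_inj[of _ 1, simplified]

lemma frob_frob: "((x :: 'k) ^ (q ^ i)) ^ (q ^ j) = x ^ (q ^ (i + j))"
  by (simp add: power_mult[symmetric] power_add)

definition F :: "nat \<Rightarrow> 'k set" where "F j = subfield_of_order (q ^ j)"

lemma F_iff: "x \<in> F j \<longleftrightarrow> x ^ (q ^ j) = x"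
  by (simp add: F_def subfield_of_order_def)

lemma F_add: "x \<in> F j \<Longrightarrow> y \<in> F j \<Longrightarrow> x + y \<in> F j" by (simp add: F_iff frob_add)
lemma F_diff: "x \<in> F j \<Longrightarrow> y \<in> F j \<Longrightarrow> x - y \<in> F j" by (simp add: F_iff frob_diff)
lemma F_mult: "x \<in> F j \<Longrightarrow> y \<in> F j \<Longrightarrow> x * y \<in> F j" by (simp add: F_iff power_mult_distrib)
lemma F_divide: "x \<in> F j \<Longrightarrow> y \<in> F j \<Longrightarrow> x / y \<in> F j" by (simp add: F_iff power_divide)
lemma F_inverse: "x \<in> F j \<Longrightarrow> inverse x \<in> F j" by (simp add: F_iff power_inverse)
lemma F_0 [simp]: "0 \<in> F j" by (simp add: F_iff)
lemma F_1 [simp]: "1 \<in> F j" by (simp add: F_iff)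
lemma F_power: "x \<in> F j \<Longrightarrow> x ^ n \<in> F j" unfolding F_iff by (metis power_mult mult.commute)
lemma F_sum: "(\<And>i. i \<in> A \<Longrightarrow> f i \<in> F j) \<Longrightarrow> sum f A \<in> F j"
  by (simp add: F_iff frob_sum)
lemma F_prod: "(\<And>i. i \<in> A \<Longrightarrow> f i \<in> F j) \<Longrightarrow> prod f A \<in> F j"
  by (simp add: F_iff prod_power_distrib)

lemma F_mult_index: assumes "x \<in> F j" shows "x \<in> F (j * k)"
proof (induction k)
  case (Suc k)
  have "x ^ (q ^ (j * k + j)) = x" using Suc assms by (simp add: F_iff flip: frob_frob)
  thus ?case by (simp add: F_iff add.commute)
qed (simp add: F_iff)

lemma F_poly: "(\<And>i. coeff p i \<in> F j) \<Longrightarrow> x \<in> F j \<Longrightarrow> poly p x \<in> F j"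
  unfolding poly_altdef by (intro F_sum F_mult F_power)

text \<open>
  The derivative of \<open>X^(q^j) - X\<close> is \<open>-1\<close>, so its roots are simple.
\<close>
lemma card_F_aux: assumes "j \<ge> 1" shows "finite (F j) \<and> card (F j) = q ^ j"
proof -
  define p :: "'k poly" where "p = monom 1 (q ^ j) - [:0, 1:]"
  have gt: "q ^ j > 1" using one_less_power[OF q_gt_1] assms by simp
  have deg: "degree p = q ^ j"
    unfolding p_def diff_conv_add_uminus using gt by (subst degree_add_eq_left) (auto simp: degree_monom_eq)
  hence "p \<noteq> 0" using gt by auto
  have roots: "{x. poly p x = 0} = F j" by (auto simp: p_def F_iff poly_monom)
  obtain s where "s > 0" "q = CHAR('k) ^ s" using q_char_power by blast
  hence "CHAR('k) dvd q ^ j" using assms by (metis dvd_power dvd_trans less_le_trans zero_less_one One_nat_def)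
  hence "of_nat (q ^ j) = (0 :: 'k)" by (simp only: of_nat_eq_0_iff_char_dvd)
  hence pd: "pderiv p = -1"
    unfolding p_def pderiv_diff pderiv_monom \<open>of_nat (q ^ j) = 0\<close> by (simp add: pderiv_pCons one_pCons)
  have ord: "order x p = 1" if x: "poly p x = 0" for x
  proof -
    have "order x p \<noteq> 0" using x \<open>p \<noteq> 0\<close> order_root by blast
    moreover have "\<not> order x p \<ge> 2"
    proof
      assume "order x p \<ge> 2"
      hence "[:-x, 1:] ^ 2 dvd p" using \<open>p \<noteq> 0\<close> by (simp add: order_divides)
      then obtain s where "p = [:-x, 1:] ^ 2 * s" by (elim dvdE)
      hence p2: "p = [:-x, 1:] * ([:-x, 1:] * s)" by (simp only: power2_eq_square mult.assoc)
      have "poly (pderiv p) x = 0"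
        unfolding p2 pderiv_mult[of "[:-x, 1:]"] by (simp add: pderiv_pCons)
      thus False by (simp add: pd)
    qed
    ultimately show ?thesis by simp
  qed
  have "finite (F j)" using poly_roots_finite[OF \<open>p \<noteq> 0\<close>] roots by simp
  moreover have "q ^ j = card (F j)"
    using degree_eq_sum_order[OF \<open>p \<noteq> 0\<close>] by (simp add: deg ord roots[symmetric])
  ultimately show ?thesis by simp
qed

lemma finite_F: "j \<ge> 1 \<Longrightarrow> finite (F j)" and card_F: "j \<ge> 1 \<Longrightarrow> card (F j) = q ^ j"
  using card_F_aux by auto

definition frob_poly :: "'k poly \<Rightarrow> 'k poly" where "frob_poly = map_poly (\<lambda>x. x ^ q)"

text \<open>
  The polynomials with coefficients in \<open>\<F>_q\<close>, as the fixed points of the Frobenius map on coefficients.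
\<close>
definition Fq_polys :: "'k poly set" where "Fq_polys = {h. frob_poly h = h}"

lemma coeff_frob_poly [simp]: "coeff (frob_poly h) i = coeff h i ^ q"
  by (simp add: frob_poly_def coeff_map_poly)

lemma frob_poly_mult: "frob_poly (g * h) = frob_poly g * frob_poly h"
  by (rule poly_eqI) (simp add: coeff_mult frob_sum1 power_mult_distrib)

lemma frob_poly_1 [simp]: "frob_poly 1 = 1"
  by (simp add: frob_poly_def)

lemma frob_poly_prod: "frob_poly (prod f A) = (\<Prod>i\<in>A. frob_poly (f i))"
  by (induction A rule: infinite_finite_induct) (simp_all add: frob_poly_mult)

lemma Fq_polys_iff: "h \<in> Fq_polys \<longleftrightarrow> (\<forall>i. coeff h i \<in> F 1)"
  by (simp add: Fq_polys_def poly_eq_iff F_iff)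

lemma Fq_polys_0 [simp]: "0 \<in> Fq_polys" and Fq_polys_1 [simp]: "1 \<in> Fq_polys" by (simp_all add: Fq_polys_iff coeff_1)
lemma Fq_polys_mult: "g \<in> Fq_polys \<Longrightarrow> h \<in> Fq_polys \<Longrightarrow> g * h \<in> Fq_polys" by (simp add: Fq_polys_def frob_poly_mult)
lemma Fq_polys_add: "g \<in> Fq_polys \<Longrightarrow> h \<in> Fq_polys \<Longrightarrow> g + h \<in> Fq_polys" by (simp add: Fq_polys_iff F_add)
lemma Fq_polys_smult: "a \<in> F 1 \<Longrightarrow> h \<in> Fq_polys \<Longrightarrow> smult a h \<in> Fq_polys" by (simp add: Fq_polys_iff F_mult)

lemma Fq_polys_cofactor: assumes "g * h \<in> Fq_polys" "g \<in> Fq_polys" "g \<noteq> 0" shows "h \<in> Fq_polys"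
proof -
  have "g * frob_poly h = g * h" using assms by (simp add: Fq_polys_def frob_poly_mult)
  thus ?thesis using assms(3) by (simp add: Fq_polys_def)
qed

lemma poly_Fq_polys_frob: assumes "h \<in> Fq_polys" shows "poly h (x ^ (q ^ j)) = poly h x ^ (q ^ j)"
proof -
  have c: "coeff h i ^ (q ^ j) = coeff h i" for i
    using assms F_mult_index[of "coeff h i" 1 j] by (simp add: Fq_polys_iff F_iff)
  show ?thesis
    by (simp add: poly_altdef frob_sum power_mult_distrib c power_mult[symmetric] mult.commute)
qed

lemma frob_orbit_periodic:
  assumes "h \<in> Fq_polys" "h \<noteq> 0" "poly h \<alpha> = 0"
  obtains j where "j \<ge> 1" "\<alpha> \<in> F j"
proof -
  have "range (\<lambda>i. \<alpha> ^ (q ^ i)) \<subseteq> {x. poly h x = 0}"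
    using assms by (auto simp: poly_Fq_polys_frob)
  hence "finite (range (\<lambda>i. \<alpha> ^ (q ^ i)))"
    using poly_roots_finite[OF assms(2)] finite_subset by blast
  hence "\<not> inj (\<lambda>i. \<alpha> ^ (q ^ i))" using finite_imageD by blast
  then obtain i i' where "i < i'" "\<alpha> ^ (q ^ i) = \<alpha> ^ (q ^ i')"
    unfolding inj_def by (metis nat_neq_iff)
  moreover have "\<alpha> ^ (q ^ i') = (\<alpha> ^ (q ^ (i' - i))) ^ (q ^ i)"
    using \<open>i < i'\<close> by (simp add: frob_frob)
  ultimately have "\<alpha> \<in> F (i' - i)" by (simp add: frob_inj F_iff)
  thus ?thesis using that[of "i' - i"] \<open>i < i'\<close> by simp
qed

text \<open>
  For \<open>\<alpha>\<close> in \<open>\<F>_{q^j}\<close> this is the characteristic polynomial of \<open>\<alpha>\<close> over \<open>\<F>_q\<close>, that is, the power of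
  its minimal polynomial that has degree \<open>j\<close>.
\<close>
definition frob_norm :: "nat \<Rightarrow> 'k \<Rightarrow> 'k poly" where
  "frob_norm j \<alpha> = (\<Prod>i<j. [:- (\<alpha> ^ (q ^ i)), 1:])"

lemma degree_frob_norm: "degree (frob_norm j \<alpha>) = j"
  unfolding frob_norm_def by (subst degree_prod_sum_eq) auto

lemma lead_coeff_frob_norm: "lead_coeff (frob_norm j \<alpha>) = 1"
  unfolding frob_norm_def by (simp add: lead_coeff_prod)

lemma frob_norm_nonzero [simp]: "frob_norm j \<alpha> \<noteq> 0"
  unfolding frob_norm_def by simp

lemma poly_frob_norm: "poly (frob_norm j \<alpha>) x = (\<Prod>i<j. x - \<alpha> ^ (q ^ i))"
  unfolding frob_norm_def by (simp add: poly_prod)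

lemma frob_norm_in_Fq_polys: assumes "\<alpha> \<in> F j" shows "frob_norm j \<alpha> \<in> Fq_polys"
proof (cases j)
  case (Suc m)
  have fl: "frob_poly [:- c, 1:] = [:- (c ^ q), 1:]" for c :: 'k
    by (simp add: poly_eq_iff coeff_pCons frob_minus1 split: nat.split)
  have "frob_poly (frob_norm j \<alpha>) = (\<Prod>i<Suc m. [:- (\<alpha> ^ (q ^ Suc i)), 1:])"
    unfolding frob_norm_def Suc by (simp only: frob_poly_prod fl) (simp add: power_mult[symmetric] mult.commute)
  also have "\<dots> = (\<Prod>i<m. [:- (\<alpha> ^ (q ^ Suc i)), 1:]) * [:- (\<alpha> ^ (q ^ 0)), 1:]"
    using assms by (simp add: F_iff Suc)
  also have "\<dots> = frob_norm j \<alpha>"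
    unfolding frob_norm_def Suc prod.lessThan_Suc_shift by (simp only: mult.commute)
  finally show ?thesis by (simp add: Fq_polys_def)
qed (simp add: frob_norm_def Fq_polys_def)

lemma frob_norm_add: assumes "\<alpha> \<in> F a" shows "frob_norm (a + b) \<alpha> = frob_norm a \<alpha> * frob_norm b \<alpha>"
proof (induction b)
  case (Suc b)
  have "\<alpha> ^ (q ^ (a + b)) = \<alpha> ^ (q ^ b)" using assms by (simp add: F_iff flip: frob_frob)
  with Suc show ?case unfolding frob_norm_def by (simp only: add_Suc_right prod.lessThan_Suc mult.assoc)
qed (simp add: frob_norm_def)

lemma frob_norm_mult: assumes "\<alpha> \<in> F e" shows "frob_norm (e * k) \<alpha> = frob_norm e \<alpha> ^ k"
proof (induction k)
  case (Suc k)
  thus ?case using frob_norm_add[OF assms, of "e * k"] by simp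
qed (simp add: frob_norm_def)

text \<open>
  Unique factorisation in \<open>\<F>_q[X]\<close>, seen from the roots. If \<open>e\<close> is the degree of \<open>\<alpha>\<close>, then the indices
  \<open>j\<close> are the multiples \<open>e k\<close>, the polynomial of index \<open>e k\<close> is the \<open>k\<close>-th power of the minimal
  polynomial, and this power divides \<open>h\<close> exactly for \<open>k\<close> up to the multiplicity of the root.
\<close>
lemma order_eq_card_norm_divisors:
  assumes "h \<in> Fq_polys" "h \<noteq> 0" "poly h \<alpha> = 0"
  shows "card {j. j \<ge> 1 \<and> \<alpha> \<in> F j \<and> frob_norm j \<alpha> dvd h} = order \<alpha> h"
proof -
  define e where "e = (LEAST j. j \<ge> 1 \<and> \<alpha> \<in> F j)"
  obtain j0 where "j0 \<ge> 1 \<and> \<alpha> \<in> F j0" using frob_orbit_periodic[OF assms] by blast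
  hence e: "e \<ge> 1" "\<alpha> \<in> F e" unfolding e_def using LeastI[of "\<lambda>j. j \<ge> 1 \<and> \<alpha> \<in> F j"] by auto
  have least: "e \<le> j" if "j \<ge> 1" "\<alpha> \<in> F j" for j
    unfolding e_def using that by (intro Least_le) auto
  have F_dvd: "\<alpha> \<in> F j \<longleftrightarrow> e dvd j" for j
  proof
    assume "\<alpha> \<in> F j"
    have "\<alpha> ^ (q ^ (e * (j div e) + j mod e)) = \<alpha> ^ (q ^ (j mod e))"
      using F_mult_index[OF e(2), of "j div e"] frob_frob[of \<alpha> "e * (j div e)" "j mod e"]
      by (simp only: F_iff)
    hence "\<alpha> \<in> F (j mod e)" using \<open>\<alpha> \<in> F j\<close> by (simp add: F_iff)
    hence "\<not> j mod e \<ge> 1" using least[of "j mod e"] e by (meson less_le_not_le mod_less_divisor not_le order.strict_trans2 zero_less_one)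
    thus "e dvd j" by (simp add: dvd_eq_mod_eq_0)
  qed (auto elim!: dvdE intro: F_mult_index e)
  have inj: "inj_on (\<lambda>i. \<alpha> ^ (q ^ i)) {..<e}"
  proof (rule linorder_inj_onI')
    fix i i' assume i: "i \<in> {..<e}" "i' \<in> {..<e}" "i < i'"
    show "\<alpha> ^ (q ^ i) \<noteq> \<alpha> ^ (q ^ i')"
    proof
      assume "\<alpha> ^ (q ^ i) = \<alpha> ^ (q ^ i')"
      also have "\<alpha> ^ (q ^ i') = (\<alpha> ^ (q ^ (i' - i))) ^ (q ^ i)"
        using i by (simp add: frob_frob)
      finally have "\<alpha> \<in> F (i' - i)" by (simp add: frob_inj F_iff)
      moreover have "1 \<le> i' - i" "i' - i < e" using i by auto
      ultimately show False using least[of "i' - i"] by linarith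
    qed
  qed
  have frob_norm_set: "frob_norm e \<alpha> = (\<Prod>x\<in>(\<lambda>i. \<alpha> ^ (q ^ i)) ` {..<e}. [:- x, 1:])"
    unfolding frob_norm_def using inj by (simp add: prod.reindex)
  have order_frob_norm: "order \<alpha> (frob_norm e \<alpha>) = 1"
  proof -
    define Q where "Q = (\<Prod>i\<in>{..<e} - {0}. [:- (\<alpha> ^ (q ^ i)), 1:])"
    have eq: "frob_norm e \<alpha> = [:- \<alpha>, 1:] * Q"
      unfolding frob_norm_def Q_def using e by (subst prod.remove[of _ 0]) auto
    have "\<alpha> \<noteq> \<alpha> ^ (q ^ i)" if "i \<in> {..<e} - {0}" for i
      using that inj_onD[OF inj, of 0 i] e by auto
    hence "poly Q \<alpha> \<noteq> 0" unfolding Q_def by (simp add: poly_prod)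
    hence "order \<alpha> Q = 0" by (rule order_0I)
    moreover have "order \<alpha> (frob_norm e \<alpha>) = order \<alpha> [:- \<alpha>, 1:] + order \<alpha> Q"
      unfolding eq by (rule order_mult) (use frob_norm_nonzero[of e \<alpha>] eq in simp)
    moreover have "order \<alpha> [:- \<alpha>, 1:] = 1"
      using order_power_n_n[of \<alpha> 1] by simp
    ultimately show ?thesis by simp
  qed
  have pow_dvd: "frob_norm e \<alpha> ^ k dvd h \<longleftrightarrow> k \<le> order \<alpha> h" for k
    using assms(1,2)
  proof (induction k arbitrary: h)
    case (Suc k)
    show ?case
    proof (cases "poly h \<alpha> = 0")
      case True
      have "frob_norm e \<alpha> dvd h" unfolding frob_norm_set
        using True Suc.prems by (intro prod_linear_dvd) (auto simp: poly_Fq_polys_frob)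
      then obtain g where g: "h = frob_norm e \<alpha> * g" by (elim dvdE)
      have "g \<in> Fq_polys" "g \<noteq> 0" using Fq_polys_cofactor[of "frob_norm e \<alpha>" g] Suc.prems frob_norm_in_Fq_polys[OF e(2)] by (auto simp: g)
      have "order \<alpha> h = Suc (order \<alpha> g)" using \<open>h \<noteq> 0\<close> order_frob_norm by (simp add: g order_mult)
      moreover have "frob_norm e \<alpha> ^ Suc k dvd h \<longleftrightarrow> frob_norm e \<alpha> ^ k dvd g"
        by (simp add: g)
      ultimately show ?thesis using Suc.IH[OF \<open>g \<in> Fq_polys\<close> \<open>g \<noteq> 0\<close>] by simp
    next
      case False
      have "poly (frob_norm e \<alpha>) \<alpha> = 0" using order_frob_norm by (metis frob_norm_nonzero order_root zero_neq_one)
      hence "\<not> frob_norm e \<alpha> ^ Suc k dvd h" using False by (metis dvdE mult_zero_left poly_mult power_Suc)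
      thus ?thesis using False by (simp add: order_0I)
    qed
  qed simp
  have "{j. j \<ge> 1 \<and> \<alpha> \<in> F j \<and> frob_norm j \<alpha> dvd h} = (\<lambda>k. e * k) ` {1..order \<alpha> h}"
  proof (intro equalityI subsetI)
    fix j assume j: "j \<in> {j. j \<ge> 1 \<and> \<alpha> \<in> F j \<and> frob_norm j \<alpha> dvd h}"
    then obtain k where k: "j = e * k" using F_dvd by (auto elim!: dvdE)
    thus "j \<in> (\<lambda>k. e * k) ` {1..order \<alpha> h}"
      using j pow_dvd[of k] frob_norm_mult[OF e(2), of k] by (intro image_eqI[of _ _ k]) (auto intro: Suc_leI gr0I)
  next
    fix j assume "j \<in> (\<lambda>k. e * k) ` {1..order \<alpha> h}"
    thus "j \<in> {j. j \<ge> 1 \<and> \<alpha> \<in> F j \<and> frob_norm j \<alpha> dvd h}"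
      using e pow_dvd frob_norm_mult[OF e(2)] F_dvd by auto
  qed
  also have "card \<dots> = order \<alpha> h" using e by (subst card_image) (auto simp: inj_on_def)
  finally show ?thesis .
qed

end

section \<open>L-functions of characters on polynomials\<close>

context frobenius
begin

definition monic_polys :: "nat \<Rightarrow> 'k poly set" where
  "monic_polys n = {h \<in> Fq_polys. degree h = n \<and> lead_coeff h = 1}"

lemma finite_Fq_polys_degree_le: "finite {h \<in> Fq_polys. degree h \<le> n}"
proof (rule finite_subset)
  show "{h \<in> Fq_polys. degree h \<le> n} \<subseteq> Poly ` {xs. set xs \<subseteq> F 1 \<and> length xs \<le> Suc n}"
  proof
    fix h assume "h \<in> {h \<in> Fq_polys. degree h \<le> n}"
    hence "set (coeffs h) \<subseteq> F 1 \<and> length (coeffs h) \<le> Suc n"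
      by (auto simp: Fq_polys_iff coeffs_def)
    thus "h \<in> Poly ` {xs. set xs \<subseteq> F 1 \<and> length xs \<le> Suc n}"
      by (intro image_eqI[of _ _ "coeffs h"]) auto
  qed
  show "finite (Poly ` {xs. set xs \<subseteq> F 1 \<and> length xs \<le> Suc n})"
    by (intro finite_imageI finite_lists_length_le finite_F) simp
qed

lemma finite_monic_polys: "finite (monic_polys n)"
  by (rule finite_subset[OF _ finite_Fq_polys_degree_le[of n]]) (auto simp: monic_polys_def)

lemma monic_polys_0: "monic_polys 0 = {1}"
  using Fq_polys_1 by (auto simp: monic_polys_def one_pCons elim!: degree_eq_zeroE)

text \<open>
  The sum of the multiplicities of all the roots of \<open>h\<close>, counted by means of \<open>order_eq_card_norm_divisors\<close>.
\<close>
lemma degree_eq_card_norm_divisors: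
  assumes "h \<in> monic_polys n"
  shows "n = (\<Sum>j=1..n. card {\<alpha> \<in> F j. frob_norm j \<alpha> dvd h})"
proof -
  have h: "h \<in> Fq_polys" "h \<noteq> 0" "degree h = n" using assms by (auto simp: monic_polys_def)
  define Z where "Z = {x. poly h x = 0}"
  have "finite Z" unfolding Z_def using poly_roots_finite[OF h(2)] .
  define T where "T = (\<lambda>x j. x \<in> F j \<and> frob_norm j x dvd h)"
  have "n = (\<Sum>x\<in>Z. order x h)"
    using degree_eq_sum_order[OF h(2)] h(3) by (simp add: Z_def)
  also have "\<dots> = (\<Sum>x\<in>Z. card {j \<in> {1..n}. T x j})"
  proof (intro sum.cong refl)
    fix x assume x: "x \<in> Z"
    have "j \<le> n" if "frob_norm j x dvd h" for j
      using dvd_imp_degree_le[OF that h(2)] h(3) by (simp add: degree_frob_norm)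
    hence "{j \<in> {1..n}. T x j} = {j. j \<ge> 1 \<and> x \<in> F j \<and> frob_norm j x dvd h}" by (auto simp: T_def)
    thus "order x h = card {j \<in> {1..n}. T x j}"
      using order_eq_card_norm_divisors[OF h(1,2), of x] x by (simp add: Z_def)
  qed
  also have "\<dots> = (\<Sum>j\<in>{1..n}. card {x \<in> Z. T x j})"
    by (rule sum_multicount_gen) (use \<open>finite Z\<close> in auto)
  also have "\<dots> = (\<Sum>j=1..n. card {\<alpha> \<in> F j. frob_norm j \<alpha> dvd h})"
  proof (intro sum.cong refl arg_cong[where f = card])
    fix j assume j: "j \<in> {1..n}"
    have "poly (frob_norm j x) x = 0" for x
      unfolding poly_frob_norm using j by (intro prod_zero bexI[of _ 0]) auto
    thus "{x \<in> Z. T x j} = {\<alpha> \<in> F j. frob_norm j \<alpha> dvd h}"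
      by (auto simp: Z_def T_def elim!: dvdE)
  qed
  finally show ?thesis .
qed

lemma bij_betw_norm_multiples:
  assumes "\<alpha> \<in> F j" "j \<le> n"
  shows "bij_betw (\<lambda>g. frob_norm j \<alpha> * g) (monic_polys (n - j)) {h \<in> monic_polys n. frob_norm j \<alpha> dvd h}"
proof (rule bij_betw_imageI)
  show "inj_on (\<lambda>g. frob_norm j \<alpha> * g) (monic_polys (n - j))" by (rule inj_onI) simp
  show "(\<lambda>g. frob_norm j \<alpha> * g) ` monic_polys (n - j) = {h \<in> monic_polys n. frob_norm j \<alpha> dvd h}"
  proof (intro equalityI subsetI)
    fix h assume "h \<in> (\<lambda>g. frob_norm j \<alpha> * g) ` monic_polys (n - j)"
    then obtain g where g: "g \<in> Fq_polys" "degree g = n - j" "lead_coeff g = 1" "h = frob_norm j \<alpha> * g"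
      by (auto simp: monic_polys_def)
    have "g \<noteq> 0" using g by auto
    thus "h \<in> {h \<in> monic_polys n. frob_norm j \<alpha> dvd h}"
      using g assms frob_norm_in_Fq_polys[OF assms(1)] lead_coeff_mult[of "frob_norm j \<alpha>" g] lead_coeff_frob_norm[of j \<alpha>]
      by (auto simp: monic_polys_def Fq_polys_mult degree_mult_eq degree_frob_norm lead_coeff_frob_norm)
  next
    fix h assume h: "h \<in> {h \<in> monic_polys n. frob_norm j \<alpha> dvd h}"
    then obtain g where g: "h = frob_norm j \<alpha> * g" by auto
    have "h \<noteq> 0" "h \<in> Fq_polys" "degree h = n" "lead_coeff h = 1" using h by (auto simp: monic_polys_def)
    have "g \<noteq> 0" using \<open>h \<noteq> 0\<close> g by auto
    have "g \<in> Fq_polys" using Fq_polys_cofactor[of "frob_norm j \<alpha>" g] \<open>h \<in> Fq_polys\<close> frob_norm_in_Fq_polys[OF assms(1)] by (simp add: g)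
    moreover have "degree g = n - j"
      using \<open>degree h = n\<close> \<open>g \<noteq> 0\<close> by (auto simp: g degree_mult_eq degree_frob_norm)
    moreover have "lead_coeff g = 1"
      using \<open>lead_coeff h = 1\<close> lead_coeff_mult[of "frob_norm j \<alpha>" g] by (simp add: g lead_coeff_frob_norm)
    ultimately show "h \<in> (\<lambda>g. frob_norm j \<alpha> * g) ` monic_polys (n - j)" unfolding g by (auto simp: monic_polys_def)
  qed
qed

end

text \<open>
  The properties of a Dirichlet character on \<open>\<F>_q[X]\<close>, extended by zero, that the Newton identity
  needs. The invariance under constants means that the point at infinity is unramified.
\<close>
locale poly_character = frobenius q ty for q :: nat and ty :: "'k::alg_closed_field itself" +
  fixes \<Psi> :: "'k poly \<Rightarrow> complex"
  assumes Psi_mult: "\<And>f g. f \<in> Fq_polys \<Longrightarrow> g \<in> Fq_polys \<Longrightarrow> \<Psi> (f * g) = \<Psi> f * \<Psi> g"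
    and Psi_0: "\<Psi> 0 = 0" and Psi_1: "\<Psi> 1 = 1"
    and Psi_smult: "\<And>a h. a \<in> F 1 \<Longrightarrow> a \<noteq> 0 \<Longrightarrow> h \<in> Fq_polys \<Longrightarrow> \<Psi> (smult a h) = \<Psi> h"
begin

text \<open>
  The generating series of \<open>monic_sum\<close> is the L-function of the affine line, that of \<open>L_coeff\<close>, its
  quotient by \<open>1 - X\<close>, the L-function of the projective line; \<open>point_sum j\<close> is the character sum over the
  \<open>\<F>_{q^j}\<close>-points of the affine line.
\<close>
definition monic_sum :: "nat \<Rightarrow> complex" where "monic_sum n = (\<Sum>h\<in>monic_polys n. \<Psi> h)"
definition point_sum :: "nat \<Rightarrow> complex" where "point_sum j = (\<Sum>\<alpha>\<in>F j. \<Psi> (frob_norm j \<alpha>))"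
definition L_coeff :: "nat \<Rightarrow> complex" where "L_coeff n = (\<Sum>m\<le>n. monic_sum m)"

text \<open>
  This plays the role of the logarithmic derivative of the Euler product. In \<open>n \<Psi>(h)\<close>, for \<open>h\<close> monic of
  degree \<open>n\<close>, the factor \<open>n\<close> counts the pairs of \<open>j\<close> and \<open>\<alpha>\<close> for which the norm polynomial of \<open>\<alpha>\<close>
  divides \<open>h\<close>; summation over the cofactor gives the right-hand side.
\<close>
lemma newton_identity: "of_nat n * monic_sum n = (\<Sum>j=1..n. point_sum j * monic_sum (n - j))"
proof -
  have "of_nat n * monic_sum n = (\<Sum>h\<in>monic_polys n. \<Sum>j=1..n. \<Sum>\<alpha>\<in>F j. if frob_norm j \<alpha> dvd h then \<Psi> h else 0)"
    unfolding monic_sum_def sum_distrib_left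
  proof (intro sum.cong refl)
    fix h assume h: "h \<in> monic_polys n"
    have "(of_nat n :: complex) = (\<Sum>j=1..n. of_nat (card {\<alpha> \<in> F j. frob_norm j \<alpha> dvd h}))"
      by (subst degree_eq_card_norm_divisors[OF h]) simp
    hence "of_nat n * \<Psi> h = (\<Sum>j=1..n. of_nat (card {\<alpha> \<in> F j. frob_norm j \<alpha> dvd h}) * \<Psi> h)"
      by (simp add: sum_distrib_right)
    also have "\<dots> = (\<Sum>j=1..n. \<Sum>\<alpha>\<in>F j. if frob_norm j \<alpha> dvd h then \<Psi> h else 0)"
      by (intro sum.cong refl) (simp add: finite_F flip: sum.inter_filter)
    finally show "of_nat n * \<Psi> h = \<dots>" .
  qed
  also have "\<dots> = (\<Sum>j=1..n. \<Sum>\<alpha>\<in>F j. \<Sum>h\<in>monic_polys n. if frob_norm j \<alpha> dvd h then \<Psi> h else 0)"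
    by (subst sum.swap, intro sum.cong refl, subst sum.swap, rule refl)
  also have "\<dots> = (\<Sum>j=1..n. point_sum j * monic_sum (n - j))"
    unfolding point_sum_def sum_distrib_right
  proof (intro sum.cong refl)
    fix j \<alpha> assume j: "j \<in> {1..n}" and \<alpha>: "\<alpha> \<in> F j"
    have "(\<Sum>h\<in>monic_polys n. if frob_norm j \<alpha> dvd h then \<Psi> h else 0) = (\<Sum>h | h \<in> monic_polys n \<and> frob_norm j \<alpha> dvd h. \<Psi> h)"
      by (simp add: finite_monic_polys sum.inter_filter)
    also have "\<dots> = (\<Sum>g\<in>monic_polys (n - j). \<Psi> (frob_norm j \<alpha> * g))"
      using j \<alpha> by (intro sum.reindex_bij_betw[symmetric] bij_betw_norm_multiples) auto
    also have "\<dots> = \<Psi> (frob_norm j \<alpha>) * monic_sum (n - j)"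
      unfolding monic_sum_def sum_distrib_left using frob_norm_in_Fq_polys[OF \<alpha>]
      by (intro sum.cong refl Psi_mult) (auto simp: monic_polys_def)
    finally show "(\<Sum>h\<in>monic_polys n. if frob_norm j \<alpha> dvd h then \<Psi> h else 0) = \<Psi> (frob_norm j \<alpha>) * monic_sum (n - j)" .
  qed
  finally show ?thesis .
qed

text \<open>
  The summand \<open>1\<close> is the value of the character at the point at infinity.
\<close>
lemma log_derivative_L:
  "fps_X * fps_deriv (Abs_fps L_coeff) = Abs_fps L_coeff * Abs_fps (\<lambda>n. if n = 0 then 0 else point_sum n + 1)"
proof -
  define L where "L = Abs_fps monic_sum"
  define \<Lambda> where "\<Lambda> = Abs_fps L_coeff"
  define T where "T = Abs_fps (\<lambda>n. if n = 0 then 0 else point_sum n)"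
  define U :: "complex fps" where "U = Abs_fps (\<lambda>n. if n = 0 then 0 else 1)"
  have LT: "fps_X * fps_deriv L = L * T"
  proof (rule fps_ext)
    fix n
    have "(T * L) $ n = (\<Sum>j=0..n. (if j = 0 then 0 else point_sum j) * monic_sum (n - j))"
      by (simp add: fps_mult_nth T_def L_def)
    also have "\<dots> = (\<Sum>j=1..n. point_sum j * monic_sum (n - j))"
      by (intro sum.mono_neutral_cong_right) auto
    also have "\<dots> = of_nat n * monic_sum n" by (rule newton_identity[symmetric])
    finally show "(fps_X * fps_deriv L) $ n = (L * T) $ n"
      by (cases n) (simp_all add: L_def mult.commute)
  qed
  have \<Lambda>: "(1 - fps_X) * \<Lambda> = L"
  proof (rule fps_ext)
    fix n show "((1 - fps_X) * \<Lambda>) $ n = L $ n"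
      by (cases n) (simp_all add: left_diff_distrib \<Lambda>_def L_def L_coeff_def)
  qed
  have U: "(1 - fps_X) * U = fps_X"
  proof (rule fps_ext)
    fix n show "((1 - fps_X) * U) $ n = fps_X $ n"
      by (cases n) (simp_all add: left_diff_distrib U_def)
  qed
  have "fps_deriv L = (1 - fps_X) * fps_deriv \<Lambda> - \<Lambda>"
    unfolding \<Lambda>[symmetric] by simp
  hence "(1 - fps_X) * (fps_X * fps_deriv \<Lambda>) = fps_X * (fps_deriv L + \<Lambda>)"
    by (simp add: mult.left_commute)
  also have "\<dots> = L * T + fps_X * \<Lambda>" unfolding LT[symmetric] by (simp add: distrib_left)
  also have "\<dots> = (1 - fps_X) * \<Lambda> * T + ((1 - fps_X) * U) * \<Lambda>" by (simp only: \<Lambda> U)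
  also have "\<dots> = (1 - fps_X) * (\<Lambda> * (T + U))" by (simp only: distrib_left mult_ac)
  finally have "(1 - fps_X) * (fps_X * fps_deriv \<Lambda>) = (1 - fps_X) * (\<Lambda> * (T + U))" .
  moreover have "(1 - fps_X :: complex fps) \<noteq> 0"
  proof
    assume "(1 - fps_X :: complex fps) = 0"
    hence "(1 - fps_X :: complex fps) $ 0 = 0" by simp
    thus False by simp
  qed
  ultimately have "fps_X * fps_deriv \<Lambda> = \<Lambda> * (T + U)" by (metis mult_left_cancel)
  also have "T + U = Abs_fps (\<lambda>n. if n = 0 then 0 else point_sum n + 1)"
    by (rule fps_ext) (simp add: T_def U_def)
  finally show ?thesis unfolding \<Lambda>_def .
qed

text \<open>
  Every nonzero polynomial is in a unique way a constant times a monic polynomial.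
\<close>
lemma sum_all_eq_L_coeff: "(\<Sum>h | h \<in> Fq_polys \<and> degree h \<le> n. \<Psi> h) = (of_nat q - 1) * L_coeff n"
proof -
  define M where "M = (\<Union>m\<in>{..n}. monic_polys m)"
  have M: "M = {h \<in> Fq_polys. degree h \<le> n \<and> lead_coeff h = 1}" by (auto simp: M_def monic_polys_def)
  have bij: "bij_betw (\<lambda>(a, h). smult a h) ((F 1 - {0}) \<times> M) {h \<in> Fq_polys. degree h \<le> n \<and> h \<noteq> 0}"
  proof (rule bij_betwI[where g = "\<lambda>h. (lead_coeff h, smult (inverse (lead_coeff h)) h)"])
    show "(\<lambda>(a, h). smult a h) \<in> (F 1 - {0}) \<times> M \<rightarrow> {h \<in> Fq_polys. degree h \<le> n \<and> h \<noteq> 0}"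
      by (auto simp: M Fq_polys_smult)
    show "(\<lambda>h. (lead_coeff h, smult (inverse (lead_coeff h)) h)) \<in> {h \<in> Fq_polys. degree h \<le> n \<and> h \<noteq> 0} \<rightarrow> (F 1 - {0}) \<times> M"
      by (auto simp: M intro!: Fq_polys_smult F_inverse) (auto simp: Fq_polys_iff)
  qed (auto simp: M)
  have "(\<Sum>h | h \<in> Fq_polys \<and> degree h \<le> n. \<Psi> h) = (\<Sum>h | h \<in> Fq_polys \<and> degree h \<le> n \<and> h \<noteq> 0. \<Psi> h)"
    by (rule sum.mono_neutral_right[OF finite_Fq_polys_degree_le]) (auto simp: Psi_0)
  also have "\<dots> = (\<Sum>(a, h)\<in>(F 1 - {0}) \<times> M. \<Psi> (smult a h))"
    using sum.reindex_bij_betw[OF bij, of \<Psi>] by (simp add: case_prod_beta)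
  also have "\<dots> = (\<Sum>(a, h)\<in>(F 1 - {0}) \<times> M. \<Psi> h)"
    by (intro sum.cong refl) (use Psi_smult in \<open>auto simp: M\<close>)
  also have "\<dots> = (\<Sum>a\<in>F 1 - {0}. \<Sum>h\<in>M. \<Psi> h)" by (simp only: sum.cartesian_product)
  also have "\<dots> = of_nat (card (F 1 - {0})) * (\<Sum>h\<in>M. \<Psi> h)" by simp
  also have "card (F 1 - {0}) = q - 1" using finite_F[of 1] card_F[of 1] by simp
  also have "(\<Sum>h\<in>M. \<Psi> h) = L_coeff n"
    unfolding M_def L_coeff_def monic_sum_def
    by (rule sum.UNION_disjoint) (auto simp: finite_monic_polys, auto simp: monic_polys_def)
  finally show ?thesis using q_gt_1 by (simp add: of_nat_diff)
qed

text \<open>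
  The vanishing hypothesis makes the L-function a polynomial of degree at most \<open>D\<close>, and the bound for
  the point sums makes its reciprocal zeros at most \<open>r\<close>.
\<close>
theorem complete_sum_bound:
  fixes r C :: real and D m :: nat
  assumes vanish: "\<And>n. n > D \<Longrightarrow> (\<Sum>h | h \<in> Fq_polys \<and> degree h \<le> n. \<Psi> h) = 0"
    and m: "m > 0" and r: "r > 0"
    and bound: "\<And>k. k \<ge> 1 \<Longrightarrow> norm (point_sum (m * k) + 1) \<le> C * (r ^ m) ^ k"
  shows "norm (1 + (\<Sum>a\<in>F 1. \<Psi> [:- a, 1:])) \<le> D * r"
proof -
  have q: "(of_nat q - 1 :: complex) \<noteq> 0" using q_gt_1 by auto
  have L_coeff_eq_0: "L_coeff n = 0" if "n > D" for n
    using sum_all_eq_L_coeff[of n] vanish[OF that] q by simp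
  define p where "p = (\<Sum>i\<le>D. monom (L_coeff i) i)"
  have coeff_p: "coeff p i = L_coeff i" for i
    using L_coeff_eq_0[of i] by (auto simp: p_def coeff_sum not_le)
  have p_fps: "fps_of_poly p = Abs_fps L_coeff"
    by (rule fps_ext) (simp add: coeff_p)
  have "degree p \<le> D" by (rule degree_le) (simp add: coeff_p L_coeff_eq_0)
  have monic_sum_0: "monic_sum 0 = 1" by (simp add: monic_sum_def monic_polys_0 Psi_1)
  have "monic_sum 1 = point_sum 1" using newton_identity[of 1] monic_sum_0 by simp
  hence L_coeff_1: "L_coeff 1 = 1 + (\<Sum>a\<in>F 1. \<Psi> [:- a, 1:])"
    using monic_sum_0 by (simp add: L_coeff_def point_sum_def frob_norm_def lessThan_Suc)
  have "norm (coeff p 1) \<le> degree p * r"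
  proof (rule linear_coeff_bound_of_power_sum_bound)
    show "coeff p 0 = 1" using monic_sum_0 by (simp add: coeff_p L_coeff_def)
    show "fps_X * fps_deriv (fps_of_poly p) = fps_of_poly p * Abs_fps (\<lambda>n. if n = 0 then 0 else point_sum n + 1)"
      unfolding p_fps by (rule log_derivative_L)
    show "norm (Abs_fps (\<lambda>n. if n = 0 then 0 else point_sum n + 1) $ (m * k)) \<le> C * (r ^ m) ^ k" if "k \<ge> 1" for k
      using bound[OF that] that m by simp
  qed (use m r in auto)
  also have "\<dots> \<le> D * r" using \<open>degree p \<le> D\<close> r by simp
  finally show ?thesis unfolding coeff_p L_coeff_1 .
qed

end

section \<open>Equidistribution and evaluation of polynomials\<close>

text \<open>
  Upper bounds for all the level sets suffice: since the sizes of the level sets have a known sum, one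
  of them can only be small at the expense of the others.
\<close>
lemma equidistributed_character_sum_bound:
  fixes \<chi> :: "'y \<Rightarrow> complex" and w :: "'x \<Rightarrow> 'y" and A B :: real
  assumes "finite S" "finite Y"
    and le1: "\<And>y. y \<in> Y \<Longrightarrow> norm (\<chi> y) \<le> 1" and sum0: "(\<Sum>y\<in>Y. \<chi> y) = 0"
    and outside: "\<And>x. x \<in> S \<Longrightarrow> w x \<notin> Y \<Longrightarrow> \<chi> (w x) = 0"
    and B: "B \<ge> 0" and level: "\<And>y. y \<in> Y \<Longrightarrow> real (card {x \<in> S. w x = y}) \<le> A + B"
    and A: "card Y * A \<le> card S"
  shows "norm (\<Sum>x\<in>S. \<chi> (w x)) \<le> 2 * card Y * B + card {x \<in> S. w x \<notin> Y}"
proof -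
  define n where "n = (\<lambda>y. real (card {x \<in> S. w x = y}))"
  have "{x \<in> S. w x \<in> Y} = (\<Union>y\<in>Y. {x \<in> S. w x = y})" by auto
  hence "card {x \<in> S. w x \<in> Y} = (\<Sum>y\<in>Y. card {x \<in> S. w x = y})"
    using assms(1,2) by (simp add: card_UN_disjoint disjoint_iff)
  moreover have "card S = card {x \<in> S. w x \<in> Y} + card {x \<in> S. w x \<notin> Y}"
    using assms(1) by (subst card_Un_disjoint[symmetric]) (auto intro!: arg_cong[where f = card])
  ultimately have total: "real (card S) = (\<Sum>y\<in>Y. n y) + card {x \<in> S. w x \<notin> Y}"
    by (simp add: n_def)
  have "(\<Sum>x\<in>S. \<chi> (w x)) = (\<Sum>x\<in>{x \<in> S. w x \<in> Y}. \<chi> (w x))"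
    using assms(1) outside by (intro sum.mono_neutral_right) auto
  also have "\<dots> = (\<Sum>y\<in>Y. \<Sum>x\<in>{x \<in> {x \<in> S. w x \<in> Y}. w x = y}. \<chi> (w x))"
    using assms(1,2) by (intro sum.group[symmetric]) auto
  also have "\<dots> = (\<Sum>y\<in>Y. of_real (n y) * \<chi> y)"
  proof (intro sum.cong refl)
    fix y assume "y \<in> Y"
    hence "{x \<in> {x \<in> S. w x \<in> Y}. w x = y} = {x \<in> S. w x = y}" by auto
    thus "(\<Sum>x\<in>{x \<in> {x \<in> S. w x \<in> Y}. w x = y}. \<chi> (w x)) = of_real (n y) * \<chi> y"
      by (simp add: n_def)
  qed
  also have "\<dots> = (\<Sum>y\<in>Y. of_real (n y - A) * \<chi> y) + of_real A * (\<Sum>y\<in>Y. \<chi> y)"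
    by (simp add: left_diff_distrib sum_subtractf sum_distrib_left)
  finally have "(\<Sum>x\<in>S. \<chi> (w x)) = (\<Sum>y\<in>Y. of_real (n y - A) * \<chi> y)" using sum0 by simp
  hence "norm (\<Sum>x\<in>S. \<chi> (w x)) = norm (\<Sum>y\<in>Y. of_real (n y - A) * \<chi> y)" by simp
  also have "\<dots> \<le> (\<Sum>y\<in>Y. 2 * B - (n y - A))"
  proof (rule sum_norm_le)
    fix y assume y: "y \<in> Y"
    have "norm (of_real (n y - A) * \<chi> y) \<le> \<bar>n y - A\<bar> * 1"
      unfolding norm_mult norm_of_real by (intro mult_left_mono le1[OF y]) auto
    also have "\<dots> \<le> 2 * B - (n y - A)" using level[OF y] B unfolding n_def mult_1_right by linarith
    finally show "norm (of_real (n y - A) * \<chi> y) \<le> 2 * B - (n y - A)" .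
  qed
  also have "\<dots> = 2 * card Y * B + card Y * A - (\<Sum>y\<in>Y. n y)"
    by (simp add: sum_subtractf sum.distrib algebra_simps)
  also have "\<dots> \<le> 2 * card Y * B + card {x \<in> S. w x \<notin> Y}" using total A by linarith
  finally show ?thesis .
qed

lemma geometric_sum_nat: "(x - 1) * (\<Sum>j<k. x ^ j) + 1 = (x :: nat) ^ k" if "x \<ge> 1"
proof (induction k)
  case (Suc k)
  have "(x - 1) * (\<Sum>j<Suc k. x ^ j) + 1 = (x - 1) * x ^ k + x ^ k"
    using Suc by (simp add: distrib_left)
  also have "\<dots> = (x - 1 + 1) * x ^ k" by (simp only: distrib_right mult_1_left)
  finally show ?case using that by simp
qed auto

lemma geometric_sum_split: "(\<Sum>j<k + m. x ^ j) = (\<Sum>j<k. x ^ j) + x ^ k * (\<Sum>j<m. (x :: nat) ^ j)"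
  by (induction m) (simp_all add: power_add distrib_left)

context frobenius
begin

definition polys_below :: "nat \<Rightarrow> 'k poly set" where "polys_below m = {h \<in> Fq_polys. \<forall>i\<ge>m. coeff h i = 0}"

lemma polys_below_degree: "{h \<in> Fq_polys. degree h \<le> n} = polys_below (Suc n)"
  by (auto simp: polys_below_def intro: degree_le) (metis coeff_eq_0 Suc_le_eq le_less_trans)

lemma finite_polys_below: "finite (polys_below m)"
  by (rule finite_subset[OF _ finite_Fq_polys_degree_le[of m]]) (auto simp: polys_below_def intro: degree_le)

lemma card_polys_below_ge: "q ^ m \<le> card (polys_below m)"
proof -
  define S where "S = {xs. set xs \<subseteq> F 1 \<and> length xs = m}"
  have "inj_on Poly S"
  proof (rule inj_onI)
    fix xs ys assume h: "xs \<in> S" "ys \<in> S" "Poly xs = Poly ys"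
    show "xs = ys"
    proof (rule nth_equalityI)
      fix i assume "i < length xs"
      moreover have "coeff (Poly xs) i = coeff (Poly ys) i" using h by simp
      ultimately show "xs ! i = ys ! i" using h(1,2) unfolding coeff_Poly_eq by (simp add: S_def nth_default_def)
    qed (use h in \<open>simp add: S_def\<close>)
  qed
  moreover have "Poly ` S \<subseteq> polys_below m"
    by (force simp: S_def polys_below_def Fq_polys_iff coeff_Poly_eq nth_default_def subset_iff)
  moreover have "card S = q ^ m"
    using card_lists_length_eq[OF finite_F[of 1], of m] card_F[of 1] by (simp add: S_def)
  ultimately show ?thesis using card_mono[OF finite_polys_below[of m]] by (metis card_image)
qed

lemma bij_betw_polys_below_split:
  "bij_betw (\<lambda>(r, g). r + monom 1 m * g) (polys_below m \<times> polys_below k) (polys_below (m + k))"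
proof (rule bij_betwI[where g = "\<lambda>h. (poly_cutoff m h, poly_shift m h)"])
  show "(\<lambda>(r, g). r + monom 1 m * g) \<in> polys_below m \<times> polys_below k \<rightarrow> polys_below (m + k)"
    by (auto simp: polys_below_def Fq_polys_iff coeff_monom_mult F_add)
  show "(\<lambda>h. (poly_cutoff m h, poly_shift m h)) \<in> polys_below (m + k) \<rightarrow> polys_below m \<times> polys_below k"
    by (auto simp: polys_below_def Fq_polys_iff coeff_poly_cutoff coeff_poly_shift)
  show "(\<lambda>(r, g). r + monom 1 m * g) (poly_cutoff m h, poly_shift m h) = h" for h :: "'k poly"
    by (auto simp: poly_eq_iff coeff_monom_mult coeff_poly_cutoff coeff_poly_shift)
  show "(\<lambda>h. (poly_cutoff m h, poly_shift m h)) ((\<lambda>(r, g). r + monom 1 m * g) u) = u"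
    if "u \<in> polys_below m \<times> polys_below k" for u
    using that by (auto simp: polys_below_def poly_eq_iff coeff_monom_mult coeff_poly_cutoff coeff_poly_shift)
qed

text \<open>
  Think of \<open>ev\<close> as reduction modulo a polynomial of degree \<open>m\<close> with the roots \<open>Z\<close>. On the polynomials
  of degree less than \<open>m\<close>, even after a shift by a fixed multiple of \<open>X^m\<close>, it is injective, hence by
  cardinality bijective onto \<open>T\<close>. So the sum of \<open>G\<close> over \<open>T\<close> occurs once for each shift.
\<close>
lemma sum_over_evaluations_eq_0:
  fixes G :: "'v \<Rightarrow> complex" and ev :: "'k poly \<Rightarrow> 'v"
  assumes Z: "finite Z" "card Z = m" and T: "finite T" "card T = q ^ m"
    and ev: "\<And>h. h \<in> Fq_polys \<Longrightarrow> ev h \<in> T"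
    and kernel: "\<And>g h x. g \<in> Fq_polys \<Longrightarrow> h \<in> Fq_polys \<Longrightarrow> ev g = ev h \<Longrightarrow> x \<in> Z \<Longrightarrow> poly g x = poly h x"
    and G: "(\<Sum>t\<in>T. G t) = 0" and n: "n \<ge> m"
  shows "(\<Sum>h\<in>polys_below n. G (ev h)) = 0"
proof -
  obtain k where k: "n = m + k" using n by (metis le_Suc_ex)
  have Fq_polys_monom: "monom 1 m * g \<in> Fq_polys" if "g \<in> Fq_polys" for g :: "'k poly"
    using that by (auto simp: Fq_polys_iff coeff_monom_mult)
  have inner: "(\<Sum>r\<in>polys_below m. G (ev (r + monom 1 m * g))) = 0" if g: "g \<in> Fq_polys" for g
  proof -
    define \<phi> where "\<phi> = (\<lambda>r. ev (r + monom 1 m * g))"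
    have mem: "r + monom 1 m * g \<in> Fq_polys" if "r \<in> polys_below m" for r
      using that Fq_polys_monom[OF g] by (auto simp: polys_below_def Fq_polys_add)
    have inj: "inj_on \<phi> (polys_below m)"
    proof (rule inj_onI)
      fix r r' assume r: "r \<in> polys_below m" "r' \<in> polys_below m" "\<phi> r = \<phi> r'"
      have "poly (r + monom 1 m * g) x = poly (r' + monom 1 m * g) x" if "x \<in> Z" for x
        using r that mem by (intro kernel) (auto simp: \<phi>_def)
      hence "Z \<subseteq> {x. poly (r - r') x = 0}" by auto
      show "r = r'"
      proof (rule ccontr)
        assume "r \<noteq> r'"
        hence nz: "r - r' \<noteq> 0" by simp
        have "m > degree (r - r')"
        proof (rule ccontr)
          assume "\<not> m > degree (r - r')"
          hence "coeff (r - r') (degree (r - r')) = 0" using r by (auto simp: polys_below_def)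
          thus False using nz leading_coeff_0_iff by blast
        qed
        moreover have "card Z \<le> card {x. poly (r - r') x = 0}"
          using \<open>Z \<subseteq> _\<close> poly_roots_finite[OF nz] by (intro card_mono)
        ultimately show False using card_poly_roots_bound[OF nz] Z(2) by linarith
      qed
    qed
    have sub: "\<phi> ` polys_below m \<subseteq> T" using ev mem by (auto simp: \<phi>_def)
    have "\<phi> ` polys_below m = T"
    proof (rule card_seteq[OF T(1) sub])
      show "card T \<le> card (\<phi> ` polys_below m)" using card_polys_below_ge[of m] T(2) by (simp add: card_image[OF inj])
    qed
    hence "bij_betw \<phi> (polys_below m) T" using inj by (simp add: bij_betw_def)
    hence "(\<Sum>r\<in>polys_below m. G (\<phi> r)) = (\<Sum>t\<in>T. G t)" by (rule sum.reindex_bij_betw)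
    thus ?thesis by (simp add: G \<phi>_def)
  qed
  have "(\<Sum>h\<in>polys_below n. G (ev h)) = (\<Sum>(r, g)\<in>polys_below m \<times> polys_below k. G (ev (r + monom 1 m * g)))"
    unfolding k using sum.reindex_bij_betw[OF bij_betw_polys_below_split[of m k], of "\<lambda>h. G (ev h)"]
    by (simp add: case_prod_beta)
  also have "\<dots> = (\<Sum>r\<in>polys_below m. \<Sum>g\<in>polys_below k. G (ev (r + monom 1 m * g)))"
    by (simp only: sum.cartesian_product)
  also have "\<dots> = (\<Sum>g\<in>polys_below k. \<Sum>r\<in>polys_below m. G (ev (r + monom 1 m * g)))"
    by (rule sum.swap)
  also have "\<dots> = 0" using inner by (intro sum.neutral) (auto simp: polys_below_def)
  finally show ?thesis .
qed

end

section \<open>Character sums of quadratic polynomials\<close>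

text \<open>
  The pole of the rational function at \<open>\<theta>\<close> and \<open>\<theta>^q\<close> is written as a zero of multiplicity \<open>\<kappa>\<close>, which
  makes no difference to the character if \<open>\<chi>\<close> is trivial on \<open>(\<kappa> + 1)\<close>-st powers in \<open>\<F>_q\<close>. The choice
  \<open>\<kappa> = 0\<close> removes the points \<open>\<theta>\<close> and \<open>\<theta>^q\<close> altogether and so lowers the degree of the L-function by two.
  The last assumption is the invariance of \<open>\<Psi>\<close> below under constants.
\<close>
locale quadratic_character = frobenius q ty for q :: nat and ty :: "'k::alg_closed_field itself" +
  fixes \<chi> :: "'k \<Rightarrow> complex" and \<beta>1 \<beta>2 \<theta> :: 'k and \<kappa> :: nat
  assumes chi_0: "\<chi> 0 = 0" and chi_1: "\<chi> 1 = 1"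
    and chi_mult: "\<And>x y. x \<in> F 4 \<Longrightarrow> y \<in> F 4 \<Longrightarrow> \<chi> (x * y) = \<chi> x * \<chi> y"
    and chi_norm: "\<And>x. x \<in> F 4 \<Longrightarrow> norm (\<chi> x) \<le> 1"
    and chi_sum: "(\<Sum>x\<in>F 4. \<chi> x) = 0"
    and beta_F4: "\<beta>1 \<in> F 4" "\<beta>2 \<in> F 4" and beta_ne: "\<beta>1 \<noteq> \<beta>2"
    and conj_inj: "inj_on (\<lambda>(\<beta>, i). \<beta> ^ (q ^ i)) ({\<beta>1, \<beta>2} \<times> {..<4})"
    and theta: "\<theta> \<in> F 2" "\<theta> ^ q \<noteq> \<theta>"
    and chi_scale: "\<And>a. a \<in> F 1 \<Longrightarrow> a \<noteq> 0 \<Longrightarrow> \<chi> (a ^ (2 + 2 * \<kappa>)) = 1"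
begin

definition \<Psi> :: "'k poly \<Rightarrow> complex" where
  "\<Psi> h = \<chi> (poly h \<beta>1 * poly h \<beta>2 * (poly h \<theta> * poly h (\<theta> ^ q)) ^ \<kappa>)"

lemma theta_F4: "\<theta> \<in> F 4" "\<theta> ^ q \<in> F 4"
  using F_mult_index[OF theta(1), of 2] by (simp_all add: F_power)

lemma F1_F4: "a \<in> F 1 \<Longrightarrow> a \<in> F 4"
  using F_mult_index[of a 1 4] by simp

lemma poly_Fq_polys_F4: "h \<in> Fq_polys \<Longrightarrow> x \<in> F 4 \<Longrightarrow> poly h x \<in> F 4"
  by (rule F_poly) (auto simp: Fq_polys_iff intro: F1_F4)

lemma conj_eq_iff:
  assumes "\<beta> \<in> {\<beta>1, \<beta>2}" "\<gamma> \<in> {\<beta>1, \<beta>2}" "i < 4" "j < 4"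
  shows "\<beta> ^ (q ^ i) = \<gamma> ^ (q ^ j) \<longleftrightarrow> \<beta> = \<gamma> \<and> i = j"
  using inj_onD[OF conj_inj, of "(\<beta>, i)" "(\<gamma>, j)"] assms by auto

lemma conj_ne_theta:
  assumes "\<beta> \<in> {\<beta>1, \<beta>2}"
  shows "\<beta> ^ (q ^ i) \<noteq> \<theta>" "\<beta> ^ (q ^ i) \<noteq> \<theta> ^ q"
proof -
  have "\<beta> ^ (q ^ i) \<notin> F 2"
  proof
    assume "\<beta> ^ (q ^ i) \<in> F 2"
    hence "(\<beta> ^ (q ^ 2)) ^ (q ^ i) = \<beta> ^ (q ^ i)" by (simp add: F_iff frob_frob add.commute)
    hence "\<beta> ^ (q ^ 2) = \<beta> ^ (q ^ 0)" by (simp add: frob_inj)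
    thus False using conj_eq_iff[of \<beta> \<beta> 2 0] assms by simp
  qed
  thus "\<beta> ^ (q ^ i) \<noteq> \<theta>" "\<beta> ^ (q ^ i) \<noteq> \<theta> ^ q" using theta F_power[OF theta(1), of q] by auto
qed

sublocale poly_character q ty \<Psi>
proof
  fix f g assume fg: "f \<in> Fq_polys" "g \<in> Fq_polys"
  have "\<Psi> (f * g) = \<chi> ((poly f \<beta>1 * poly f \<beta>2 * (poly f \<theta> * poly f (\<theta> ^ q)) ^ \<kappa>) *
      (poly g \<beta>1 * poly g \<beta>2 * (poly g \<theta> * poly g (\<theta> ^ q)) ^ \<kappa>))"
    by (simp add: \<Psi>_def power_mult_distrib mult_ac)
  also have "\<dots> = \<Psi> f * \<Psi> g" unfolding \<Psi>_def
    by (intro chi_mult F_mult F_power poly_Fq_polys_F4 fg beta_F4 theta_F4)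
  finally show "\<Psi> (f * g) = \<Psi> f * \<Psi> g" .
next
  fix a h assume a: "a \<in> F 1" "a \<noteq> 0" and h: "h \<in> Fq_polys"
  have "\<Psi> (smult a h) = \<chi> (a ^ (2 + 2 * \<kappa>) * (poly h \<beta>1 * poly h \<beta>2 * (poly h \<theta> * poly h (\<theta> ^ q)) ^ \<kappa>))"
    by (simp add: \<Psi>_def power_mult_distrib power_add mult_ac power2_eq_square power_mult)
  also have "\<dots> = \<chi> (a ^ (2 + 2 * \<kappa>)) * \<Psi> h" unfolding \<Psi>_def
    by (intro chi_mult F_mult F_power poly_Fq_polys_F4 h beta_F4 theta_F4 F1_F4 a)
  finally show "\<Psi> (smult a h) = \<Psi> h" using chi_scale[OF a] by simp
qed (simp_all add: \<Psi>_def chi_0 chi_1)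

text \<open>
  The value of \<open>\<Psi>\<close> at \<open>h\<close> depends only on \<open>h(\<beta>1)\<close>, \<open>h(\<beta>2)\<close> and, unless \<open>\<kappa> = 0\<close>, on \<open>h(\<theta>)\<close>. These values
  determine \<open>h\<close> at all the \<open>8 + 2\<close> (or \<open>8\<close>) conjugates of the three points, and the sum over the first of
  them vanishes by \<open>chi_sum\<close>.
\<close>
lemma sum_Psi_eq_0:
  assumes n: "n > (if \<kappa> = 0 then 6 else 8)"
  shows "(\<Sum>h | h \<in> Fq_polys \<and> degree h \<le> n. \<Psi> h) = 0"
proof -
  define \<Theta> where "\<Theta> = (if \<kappa> = 0 then {0} else F 2)"
  define T where "T = F 4 \<times> F 4 \<times> \<Theta>"
  define ev where "ev = (\<lambda>h. (poly h \<beta>1, poly h \<beta>2, if \<kappa> = 0 then 0 else poly h \<theta>))"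
  define G where "G = (\<lambda>(a, b, c). \<chi> (a * b * (c * c ^ q) ^ \<kappa>))"
  define m :: nat where "m = (if \<kappa> = 0 then 8 else 10)"
  define Z1 where "Z1 = (\<lambda>(\<beta>, i). \<beta> ^ (q ^ i)) ` ({\<beta>1, \<beta>2} \<times> {..<4})"
  define Z where "Z = Z1 \<union> (if \<kappa> = 0 then {} else {\<theta>, \<theta> ^ q})"
  have "card Z1 = 8" unfolding Z1_def card_image[OF conj_inj] using beta_ne by (simp add: card_cartesian_product)
  moreover have "x \<noteq> \<theta> \<and> x \<noteq> \<theta> ^ q" if "x \<in> Z1" for x
    using that by (auto simp: Z1_def conj_ne_theta conj_ne_theta[symmetric])
  hence "Z1 \<inter> {\<theta>, \<theta> ^ q} = {}" by blast
  moreover have "finite Z1" by (simp add: Z1_def)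
  ultimately have Z: "finite Z" "card Z = m"
    using theta(2) by (auto simp: Z_def m_def card_Un_disjoint)
  have \<Theta>: "finite \<Theta>" "\<Theta> \<subseteq> F 4"
    using F_mult_index[of _ 2 2] by (auto simp: \<Theta>_def finite_F)
  have T: "finite T" "card T = q ^ m"
    using \<Theta> by (auto simp: T_def finite_F card_cartesian_product card_F m_def \<Theta>_def simp flip: power_add)
  have ev_T: "ev h \<in> T" if "h \<in> Fq_polys" for h
  proof -
    have "poly h \<theta> \<in> F 2"
      using that theta(1) F_mult_index[of _ 1 2] by (intro F_poly) (auto simp: Fq_polys_iff)
    thus ?thesis using that poly_Fq_polys_F4 beta_F4 by (auto simp: ev_def T_def \<Theta>_def)
  qed
  have kernel: "poly g x = poly h x" if "g \<in> Fq_polys" "h \<in> Fq_polys" "ev g = ev h" "x \<in> Z" for g h x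
    using that poly_Fq_polys_frob[of _ _ 1]
    by (auto simp: Z_def Z1_def ev_def poly_Fq_polys_frob split: if_splits)
  have G_sum: "(\<Sum>t\<in>T. G t) = 0"
  proof -
    have "(\<Sum>t\<in>T. G t) = (\<Sum>a\<in>F 4. \<Sum>(b, c)\<in>F 4 \<times> \<Theta>. G (a, b, c))"
      unfolding T_def by (simp add: sum.cartesian_product case_prod_beta)
    also have "\<dots> = (\<Sum>a\<in>F 4. \<chi> a * (\<Sum>(b, c)\<in>F 4 \<times> \<Theta>. \<chi> (b * (c * c ^ q) ^ \<kappa>)))"
      unfolding sum_distrib_left
    proof (intro sum.cong refl, clarify)
      fix a b c assume "a \<in> F 4" "b \<in> F 4" "c \<in> \<Theta>"
      hence "\<chi> (a * (b * (c * c ^ q) ^ \<kappa>)) = \<chi> a * \<chi> (b * (c * c ^ q) ^ \<kappa>)"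
        using \<Theta> by (intro chi_mult F_mult F_power) auto
      thus "G (a, b, c) = \<chi> a * \<chi> (b * (c * c ^ q) ^ \<kappa>)" by (simp add: G_def mult.assoc)
    qed
    also have "\<dots> = 0" by (simp add: chi_sum flip: sum_distrib_right)
    finally show ?thesis .
  qed
  have G_ev: "\<Psi> h = G (ev h)" if "h \<in> Fq_polys" for h
    using that poly_Fq_polys_frob[of h \<theta> 1] by (simp add: \<Psi>_def G_def ev_def)
  have "(\<Sum>h | h \<in> Fq_polys \<and> degree h \<le> n. \<Psi> h) = (\<Sum>h\<in>polys_below (Suc n). G (ev h))"
    unfolding polys_below_degree by (intro sum.cong refl G_ev) (simp add: polys_below_def)
  also have "\<dots> = 0"
    by (rule sum_over_evaluations_eq_0[OF Z T ev_T kernel G_sum])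
       (use n in \<open>auto simp: m_def split: if_splits\<close>)
  finally show ?thesis .
qed

text \<open>
  The value of \<open>\<Psi>\<close> at a product of factors \<open>X - x\<close> is \<open>\<chi>\<close> of the product of the values \<open>f(x)\<close>. For
  \<open>x\<close> in \<open>\<F>_{q^(4m)}\<close>, the product of \<open>f\<close> over the conjugates of \<open>x\<close> is the norm of \<open>G(x)\<close> from
  \<open>\<F>_{q^(4m)}\<close> down to \<open>\<F>_{q^4}\<close>; the polynomial \<open>G\<close> does not depend on \<open>m\<close>.
\<close>
definition f :: "'k poly" where
  "f = [:\<beta>1, -1:] * ([:\<beta>2, -1:] * ([:\<theta>, -1:] * [:\<theta> ^ q, -1:]) ^ \<kappa>)"

definition G :: "'k poly" where "G = (\<Prod>i<4. f \<circ>\<^sub>p monom 1 (q ^ i))"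

lemma poly_f: "poly f x = (\<beta>1 - x) * ((\<beta>2 - x) * ((\<theta> - x) * (\<theta> ^ q - x)) ^ \<kappa>)"
  by (simp only: f_def poly_mult poly_power) simp

lemma poly_G: "poly G x = (\<Prod>i<4. poly f (x ^ (q ^ i)))"
  by (simp add: G_def poly_prod poly_pcompose poly_monom)

lemma Psi_frob_norm: "\<Psi> (frob_norm n \<alpha>) = \<chi> (\<Prod>i<n. poly f (\<alpha> ^ (q ^ i)))"
  unfolding \<Psi>_def poly_frob_norm poly_f prod.distrib power_mult_distrib prod_power_distrib
  by (simp only: mult.assoc)

lemma poly_f_frob: "poly f (x ^ (q ^ (4 * m))) = poly f x ^ (q ^ (4 * m))"
proof -
  have c: "c ^ (q ^ (4 * m)) = c" if "c \<in> F 4" for c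
    using F_mult_index[OF that, of m] by (simp add: F_iff)
  have p: "(y ^ \<kappa>) ^ (q ^ (4 * m)) = (y ^ (q ^ (4 * m))) ^ \<kappa>" for y :: 'k
    by (simp add: mult.commute flip: power_mult)
  show ?thesis
    unfolding poly_f power_mult_distrib p frob_diff c[OF beta_F4(1)] c[OF beta_F4(2)]
      c[OF theta_F4(1)] c[OF theta_F4(2)] ..
qed

lemma prod_f_eq_power_G: "(\<Prod>i<4 * m. poly f (\<alpha> ^ (q ^ i))) = poly G \<alpha> ^ (\<Sum>j<m. (q ^ 4) ^ j)"
proof (induction m)
  case (Suc m)
  have "(\<Prod>i<4 * Suc m. poly f (\<alpha> ^ (q ^ i))) =
      (\<Prod>i<4 * m. poly f (\<alpha> ^ (q ^ i))) * (\<Prod>i<4. poly f (\<alpha> ^ (q ^ (i + 4 * m))))"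
    by (simp add: eval_nat_numeral mult.assoc)
  also have "(\<Prod>i<4. poly f (\<alpha> ^ (q ^ (i + 4 * m)))) = poly G \<alpha> ^ ((q ^ 4) ^ m)"
    unfolding frob_frob[symmetric] poly_f_frob poly_G prod_power_distrib[symmetric] by (simp add: power_mult)
  finally show ?case using Suc by (simp add: power_add mult.commute)
qed simp

text \<open>
  The other factors \<open>f(X^(q^i))\<close> of \<open>G\<close> do not vanish at \<open>\<beta>1\<close>, because no other conjugate of \<open>\<beta>1\<close> is
  a root of \<open>f\<close>.
\<close>
lemma G_simple_root:
  obtains H where "G = [:- \<beta>1, 1:] * H" "poly H \<beta>1 \<noteq> 0"
proof
  define Q where "Q = (\<Prod>i\<in>{1..<4}. f \<circ>\<^sub>p monom 1 (q ^ i))"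
  define f' where "f' = - (([:\<beta>2, -1:] * ([:\<theta>, -1:] * [:\<theta> ^ q, -1:]) ^ \<kappa>))"
  have "{..<4} = insert 0 {1..<4::nat}" by auto
  hence "G = (f \<circ>\<^sub>p monom 1 (q ^ 0)) * Q" unfolding G_def Q_def by simp
  also have "f \<circ>\<^sub>p monom 1 (q ^ 0) = f" by (simp add: monom_altdef pcompose_idR)
  finally have "G = f * Q" .
  moreover have "[:\<beta>1, -1:] = - [:- \<beta>1, 1:]" by simp
  hence "f = [:- \<beta>1, 1:] * f'" unfolding f_def f'_def by (simp only: mult_minus_left mult_minus_right)
  ultimately show "G = [:- \<beta>1, 1:] * (f' * Q)" by (simp only: mult.assoc)
  have "poly f (\<beta>1 ^ (q ^ i)) \<noteq> 0" if "i \<in> {1..<4}" for i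
    using that conj_eq_iff[of \<beta>1 \<beta>1 0 i] conj_eq_iff[of \<beta>2 \<beta>1 0 i] conj_ne_theta[of \<beta>1 i]
    by (auto simp: poly_f)
  hence "poly Q \<beta>1 \<noteq> 0"
    by (auto simp: Q_def poly_prod poly_pcompose poly_monom)
  moreover have "poly f' \<beta>1 \<noteq> 0"
  proof -
    have "poly f' \<beta>1 = - ((\<beta>2 - \<beta>1) * ((\<theta> - \<beta>1) * (\<theta> ^ q - \<beta>1)) ^ \<kappa>)"
      by (simp only: f'_def poly_minus poly_mult poly_power) simp
    thus ?thesis using beta_ne conj_ne_theta[of \<beta>1 0] by auto
  qed
  ultimately show "poly (f' * Q) \<beta>1 \<noteq> 0" by simp
qed

text \<open>
  With \<open>R = q^(4k)\<close> and \<open>d = q^4 - 1\<close>, the norm from \<open>\<F>_{q^(8k)}\<close> to \<open>\<F>_{q^4}\<close> is the power with exponent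
  \<open>(R\<^sup>2 - 1)/d = e (R + 1)\<close>. So each fibre of the norm of \<open>G\<close> is a level set of the kind bounded above,
  with at most \<open>e R + O(R)\<close> elements, while the average size is about \<open>R\<^sup>2/d\<close>. Working with all \<open>d\<close>
  values, rather than with those of \<open>\<chi>\<close>, avoids any reference to the order of \<open>\<chi>\<close>. The exponent \<open>8k\<close>
  is chosen so that \<open>d\<close> divides \<open>R - 1\<close>.
\<close>
lemma power_sum_bound: "\<exists>C::real. \<forall>k\<ge>1. norm (point_sum (8 * k) + 1) \<le> C * (real q ^ 4) ^ k"
proof -
  obtain H where H: "G = [:- \<beta>1, 1:] * H" "poly H \<beta>1 \<noteq> 0" by (rule G_simple_root)
  define g where "g = degree H + 1"
  have "H \<noteq> 0" using H(2) by auto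
  have degG: "degree G = g" unfolding H(1) g_def using \<open>H \<noteq> 0\<close> by (subst degree_mult_eq) auto
  have "G \<noteq> 0" using degG by (auto simp: g_def)
  define d where "d = q ^ 4 - 1"
  have "q ^ 4 \<ge> 2 ^ 4" using q_gt_1 by (intro power_mono) auto
  hence d2: "d \<ge> 2" and dq: "q ^ 4 = d + 1" unfolding d_def by auto
  obtain t where t: "q = CHAR('k) ^ t" using q_char_power by blast
  have "norm (point_sum (8 * k) + 1) \<le> (4 * d * g + g + 1) * (real q ^ 4) ^ k" if k: "k \<ge> 1" for k
  proof -
    define R where "R = q ^ (4 * k)"
    define e where "e = (\<Sum>j<k. (q ^ 4) ^ j)"
    have R4: "R = (q ^ 4) ^ k" by (simp add: R_def power_mult)
    have de: "R = d * e + 1"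
      unfolding R4 e_def d_def by (rule geometric_sum_nat[symmetric]) (use dq in simp)
    have e1: "e \<ge> 1"
    proof (rule ccontr)
      assume "\<not> e \<ge> 1"
      hence "R = 1" using de by simp
      thus False using one_less_power[OF q_gt_1, of "4 * k"] k by (simp add: R_def)
    qed
    have R_sq: "R\<^sup>2 = q ^ (8 * k)" by (simp add: R_def mult.commute flip: power_mult)
    have R_char: "R = CHAR('k) ^ (t * (4 * k))" by (simp add: R_def t power_mult)
    define c where "c = e * (R + 1)"
    have "(\<Sum>j<k + k. (q ^ 4) ^ j) = e + R * e"
      unfolding e_def R4 by (rule geometric_sum_split)
    hence c: "(\<Sum>j<2 * k. (q ^ 4) ^ j) = c"
      unfolding mult_2 c_def by (simp add: distrib_left mult.commute)
    have dc: "R\<^sup>2 = d * c + 1"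
      by (simp add: c_def de power2_eq_square algebra_simps)
    define S where "S = F (8 * k)"
    have finX: "finite S" and cardX: "card S = R\<^sup>2"
      using k finite_F[of "8 * k"] card_F[of "8 * k"] by (simp_all add: S_def R_sq)
    define w where "w = (\<lambda>x. poly G x ^ c)"
    have F4_X: "x \<in> S" if "x \<in> F 4" for x
      using F_mult_index[OF that, of "2 * k"] by (simp add: S_def)
    have w_F4: "w x \<in> F 4" if x: "x \<in> S" for x
    proof -
      have "poly G x \<in> S"
        unfolding poly_G poly_f S_def using x F4_X beta_F4 theta_F4
        by (intro F_prod F_mult F_power F_diff) (auto simp: S_def)
      hence Gx: "poly G x ^ (d * c + 1) = poly G x" unfolding S_def F_iff R_sq[symmetric] dc .
      have "c \<ge> 1" using e1 by (simp add: c_def)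
      have "w x ^ (q ^ 4) = poly G x ^ (d * c + 1) * poly G x ^ (c - 1)"
        unfolding w_def dq using \<open>c \<ge> 1\<close> by (simp add: algebra_simps flip: power_mult power_add power_Suc)
      also have "\<dots> = w x" unfolding Gx w_def using \<open>c \<ge> 1\<close> by (simp flip: power_Suc)
      finally show ?thesis by (simp add: F_iff)
    qed
    define Y where "Y = F 4 - {0}"
    have finY: "finite Y" and cardY: "card Y = d"
      using finite_F[of 4] card_F[of 4] by (simp_all add: Y_def d_def)
    have "norm (\<Sum>x\<in>S. \<chi> (w x)) \<le> 2 * card Y * real (2 * g * R) + card {x \<in> S. w x \<notin> Y}"
    proof (rule equidistributed_character_sum_bound[where A = "real (e * R)"])
      show "(\<Sum>y\<in>Y. \<chi> y) = 0"
        using chi_sum finite_F[of 4] by (simp add: Y_def sum_diff1 chi_0)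
      show "\<chi> (w x) = 0" if "x \<in> S" "w x \<notin> Y" for x
        using w_F4[OF that(1)] that(2) by (simp add: Y_def chi_0)
      have "card Y * (e * R) \<le> card S"
        by (simp add: cardX cardY power2_eq_square de algebra_simps)
      thus "real (card Y) * real (e * R) \<le> real (card S)" by (simp only: of_nat_mult[symmetric] of_nat_le_iff)
      show "real (card {x \<in> S. w x = y}) \<le> real (e * R) + real (2 * g * R)" if y: "y \<in> Y" for y
      proof -
        have "\<beta>1 ^ (R\<^sup>2) = \<beta>1" using F4_X[OF beta_F4(1)] by (simp add: S_def F_iff R_sq)
        from level_set_bound[OF prime_char R_char de d2 e1 H(2) g_def _ this, of y] y
        have "card {x. x ^ (R\<^sup>2) = x \<and> poly ([:- \<beta>1, 1:] * H) x ^ (e * (R + 1)) = y} \<le> e * R + 2 * g * R"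
          by (simp add: Y_def)
        also have "{x. x ^ (R\<^sup>2) = x \<and> poly ([:- \<beta>1, 1:] * H) x ^ (e * (R + 1)) = y} = {x \<in> S. w x = y}"
          by (simp only: S_def F_iff R_sq w_def c_def H(1) Collect_conj_eq Collect_mem_eq mem_Collect_eq)
        finally show ?thesis by (simp only: of_nat_add[symmetric] of_nat_le_iff)
      qed
    qed (use finX finY chi_norm in \<open>auto simp: Y_def\<close>)
    also have "card {x \<in> S. w x \<notin> Y} \<le> g"
    proof -
      have "{x \<in> S. w x \<notin> Y} \<subseteq> {x. poly G x = 0}"
        using w_F4 by (auto simp: Y_def w_def)
      hence "card {x \<in> S. w x \<notin> Y} \<le> card {x. poly G x = 0}"
        using poly_roots_finite[OF \<open>G \<noteq> 0\<close>] by (intro card_mono)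
      also have "\<dots> \<le> g" using card_poly_roots_bound[OF \<open>G \<noteq> 0\<close>] degG by simp
      finally show ?thesis .
    qed
    finally have "norm (\<Sum>x\<in>S. \<chi> (w x)) \<le> 2 * real d * real (2 * g * R) + g" by (simp add: cardY)
    moreover have "point_sum (8 * k) = (\<Sum>x\<in>S. \<chi> (w x))"
      unfolding point_sum_def S_def
    proof (intro sum.cong refl)
      fix x
      have "(8 * k) = 4 * (2 * k)" by simp
      thus "\<Psi> (frob_norm (8 * k) x) = \<chi> (w x)" unfolding Psi_frob_norm w_def by (simp only: prod_f_eq_power_G c)
    qed
    ultimately have "norm (point_sum (8 * k) + 1) \<le> 2 * real d * real (2 * g * R) + g + 1"
      using norm_triangle_ineq[of "point_sum (8 * k)" 1] by simp
    also have "\<dots> \<le> (4 * d * g + g + 1) * real R"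
    proof -
      have "2 * d * (2 * g * R) + g + 1 \<le> (4 * d * g + g + 1) * R"
        using de by (simp add: algebra_simps)
      hence "real (2 * d * (2 * g * R) + g + 1) \<le> real ((4 * d * g + g + 1) * R)" by (simp only: of_nat_le_iff)
      thus ?thesis by (simp add: algebra_simps)
    qed
    also have "real R = (real q ^ 4) ^ k" by (simp add: R4)
    finally show ?thesis by simp
  qed
  thus ?thesis by blast
qed

theorem quadratic_character_sum_bound:
  "norm (1 + (\<Sum>a\<in>F 1. \<chi> ((\<beta>1 - a) * (\<beta>2 - a) * ((\<theta> - a) * (\<theta> ^ q - a)) ^ \<kappa>)))
     \<le> (if \<kappa> = 0 then 6 else 8) * sqrt (real q)"
proof -
  obtain C :: real where C: "\<And>k. k \<ge> 1 \<Longrightarrow> norm (point_sum (8 * k) + 1) \<le> C * (real q ^ 4) ^ k"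
    using power_sum_bound by blast
  have r8: "sqrt (real q) ^ 8 = real q ^ 4" using power_mult[of "sqrt (real q)" 2 4] by simp
  have "norm (1 + (\<Sum>a\<in>F 1. \<Psi> [:- a, 1:])) \<le> real (if \<kappa> = 0 then 6 else 8) * sqrt (real q)"
  proof (rule complete_sum_bound[where m = 8 and C = C])
    show "norm (point_sum (8 * k) + 1) \<le> C * (sqrt (real q) ^ 8) ^ k" if "k \<ge> 1" for k
      using C[OF that] unfolding r8 .
  qed (use sum_Psi_eq_0 in auto)
  moreover have "\<Psi> [:- a, 1:] = \<chi> ((\<beta>1 - a) * (\<beta>2 - a) * ((\<theta> - a) * (\<theta> ^ q - a)) ^ \<kappa>)" for a
    by (simp add: \<Psi>_def)
  ultimately show ?thesis by (simp split: if_splits)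
qed

end

section \<open>Parametrisation of the conic\<close>

locale conic = frobenius q ty for q :: nat and ty :: "'k::alg_closed_field itself" +
  fixes \<Delta> :: 'k
  assumes odd_q: "odd q" and Delta_nz: "\<Delta> \<noteq> 0" and Delta_frob: "\<Delta> ^ q = - \<Delta>"
begin

lemma two_nz [simp]: "(2 :: 'k) \<noteq> 0"
proof
  assume "(2 :: 'k) = 0"
  hence "CHAR('k) dvd 2" using of_nat_eq_0_iff_char_dvd[of 2, where 'a = 'k] by simp
  hence "CHAR('k) = 2" using prime_char two_is_prime_nat primes_dvd_imp_eq by blast
  thus False using odd_q q_char_power by auto
qed

lemma four_nz [simp]: "(4 :: 'k) \<noteq> 0"
proof -
  have "(2 :: 'k) * 2 \<noteq> 0" by (simp only: mult_eq_0_iff two_nz) simp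
  thus ?thesis by simp
qed

lemma eq_neg_self: "x = 0" if "x = - x" for x :: 'k
proof -
  have "x + x = 0" using that eq_neg_iff_add_eq_0 by blast
  hence "2 * x = 0" by (simp only: mult_2)
  thus ?thesis by simp
qed

lemma two_frob: "(2 :: 'k) ^ q = 2"
  using frob_add1[of 1 1] by simp

lemma q_ge_3: "q \<ge> 3"
proof (rule ccontr)
  assume "\<not> q \<ge> 3"
  with q_gt_1 have "q = 2" by simp
  with odd_q show False by simp
qed

lemma Delta_F2: "\<Delta> \<in> F 2"
  using Delta_frob by (simp add: F_iff power2_eq_square power_mult frob_minus1)

lemma Delta_not_fixed: "\<Delta> ^ q \<noteq> \<Delta>"
proof
  assume "\<Delta> ^ q = \<Delta>"
  hence "\<Delta> = - \<Delta>" using Delta_frob by simp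
  thus False using Delta_nz eq_neg_self by blast
qed

lemma shift_nz: assumes "a \<in> F 1" shows "a + \<Delta> \<noteq> 0" "a - \<Delta> \<noteq> 0"
proof -
  have "x \<noteq> \<Delta>" "x \<noteq> - \<Delta>" if "x \<in> F 1" for x
    using that Delta_not_fixed by (auto simp: F_iff frob_minus1)
  from this[OF assms] show "a + \<Delta> \<noteq> 0" "a - \<Delta> \<noteq> 0" by (auto simp: add_eq_0_iff2)
qed

text \<open>
  The affine points \<open>u = 1\<close> of the conic and, under \<open>z = w + w^q\<close>, their image: a coset of the group of
  elements of norm \<open>1\<close> from \<open>\<F>_{q^2}\<close> to \<open>\<F>_q\<close>.
\<close>
definition affine_conic :: "'k set" where "affine_conic = {w. w ^ (q\<^sup>2) = - w \<and> w\<^sup>2 - w ^ (2 * q) = \<Delta>}"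
definition norm_coset :: "'k set" where "norm_coset = {z. z ^ (q + 1) = - \<Delta>}"

lemma norm_coset_nz: "z \<in> norm_coset \<Longrightarrow> z \<noteq> 0" using Delta_nz by (auto simp: norm_coset_def)

lemma norm_coset_frob: "z \<in> norm_coset \<longleftrightarrow> z \<noteq> 0 \<and> z ^ q = - \<Delta> / z"
proof (cases "z = 0")
  case True
  thus ?thesis using norm_coset_nz by blast
next
  case False
  have "z \<in> norm_coset \<longleftrightarrow> z ^ q * z = - \<Delta>" by (simp only: norm_coset_def mem_Collect_eq power_add power_one_right)
  thus ?thesis using False nonzero_eq_divide_eq[OF False, of "z ^ q" "- \<Delta>"] by blast
qed

text \<open>
  The equation of the conic is \<open>(w + w^q)(w - w^q) = \<Delta>\<close>, so \<open>\<Delta>/z = w - w^q\<close>.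
\<close>
lemma bij_betw_norm_coset_affine_conic: "bij_betw (\<lambda>z. (z + \<Delta> / z) / 2) norm_coset affine_conic"
proof (rule bij_betwI[where g = "\<lambda>w. w + w ^ q"])
  have quot: "- \<Delta> / (- \<Delta> / z) = z" if "z \<noteq> 0" for z
    using that Delta_nz by simp
  have half: "((z + \<Delta> / z) / 2) ^ q = (z - \<Delta> / z) / 2"
    and half2: "((z - \<Delta> / z) / 2) ^ q = - ((z + \<Delta> / z) / 2)" if z: "z \<in> norm_coset" for z
  proof -
    have zq: "z ^ q = - \<Delta> / z" and nz: "z \<noteq> 0" using z norm_coset_frob by auto
    have "((z + \<Delta> / z) / 2) ^ q = (- \<Delta> / z + z) / 2"
      unfolding power_divide frob_add1 two_frob Delta_frob zq quot[OF nz] ..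
    thus "((z + \<Delta> / z) / 2) ^ q = (z - \<Delta> / z) / 2" by simp
    have "((z - \<Delta> / z) / 2) ^ q = (- \<Delta> / z - z) / 2"
      unfolding power_divide frob_diff1 two_frob Delta_frob zq quot[OF nz] ..
    also have "\<dots> = - ((z + \<Delta> / z) / 2)" by (simp only: minus_divide_left minus_add) simp
    finally show "((z - \<Delta> / z) / 2) ^ q = - ((z + \<Delta> / z) / 2)" .
  qed
  have double: "w ^ (2 * q) = (w ^ q) * (w ^ q)" for w :: 'k
    by (simp only: mult_2 power_add)
  have average: "(a + b) / 2 + (a - b) / 2 = a" "(a + b) / 2 - (a - b) / 2 = b" for a b :: 'k
  proof -
    have "(a + b) / 2 + (a - b) / 2 = (2 * a) / 2" unfolding add_divide_distrib[symmetric] mult_2 by simp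
    thus "(a + b) / 2 + (a - b) / 2 = a" by simp
    have "(a + b) / 2 - (a - b) / 2 = (2 * b) / 2" unfolding diff_divide_distrib[symmetric] mult_2 by simp
    thus "(a + b) / 2 - (a - b) / 2 = b" by simp
  qed
  show "(\<lambda>z. (z + \<Delta> / z) / 2) \<in> norm_coset \<rightarrow> affine_conic"
  proof
    fix z assume z: "z \<in> norm_coset"
    have "z \<noteq> 0" using norm_coset_nz z by auto
    define w where "w = (z + \<Delta> / z) / 2"
    have w1: "w ^ q = (z - \<Delta> / z) / 2" unfolding w_def by (rule half[OF z])
    have "w ^ (q\<^sup>2) = - w"
      unfolding power2_eq_square power_mult w1 unfolding w_def by (rule half2[OF z])
    moreover have "w\<^sup>2 - w ^ (2 * q) = (w + w ^ q) * (w - w ^ q)"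
      unfolding double power2_eq_square by (simp only: square_diff_square_factored)
    moreover have "w - w ^ q = \<Delta> / z" "w + w ^ q = z" unfolding w1 unfolding w_def by (rule average)+
    ultimately have "w \<in> affine_conic" using \<open>z \<noteq> 0\<close> by (simp add: affine_conic_def)
    thus "(z + \<Delta> / z) / 2 \<in> affine_conic" by (simp add: w_def)
  qed
  have conic_eq: "(w + w ^ q) * (w - w ^ q) = \<Delta>" "(w + w ^ q) ^ q = - (w - w ^ q)" if "w \<in> affine_conic" for w
  proof -
    have "w * w - (w ^ q) * (w ^ q) = \<Delta>" using that by (simp only: affine_conic_def mem_Collect_eq double power2_eq_square)
    thus "(w + w ^ q) * (w - w ^ q) = \<Delta>" by (simp only: square_diff_square_factored)
    have "(w ^ q) ^ q = - w" using that by (simp only: affine_conic_def mem_Collect_eq power_mult power2_eq_square)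
    thus "(w + w ^ q) ^ q = - (w - w ^ q)" by (simp add: frob_add1)
  qed
  show "(\<lambda>w. w + w ^ q) \<in> affine_conic \<rightarrow> norm_coset"
  proof
    fix w assume w: "w \<in> affine_conic"
    have "(w + w ^ q) ^ (q + 1) = - (w - w ^ q) * (w + w ^ q)"
      by (simp only: power_add power_one_right conic_eq(2)[OF w])
    also have "\<dots> = - ((w + w ^ q) * (w - w ^ q))" by (simp only: mult_minus_left mult.commute[of "w - w ^ q"])
    finally show "w + w ^ q \<in> norm_coset" using conic_eq(1)[OF w] by (simp only: norm_coset_def mem_Collect_eq)
  qed
  show "(z + \<Delta> / z) / 2 + ((z + \<Delta> / z) / 2) ^ q = z" if "z \<in> norm_coset" for z
    unfolding half[OF that] by (rule average)
  show "((w + w ^ q) + \<Delta> / (w + w ^ q)) / 2 = w" if "w \<in> affine_conic" for w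
  proof -
    have nz: "w + w ^ q \<noteq> 0" using conic_eq(1)[OF that] Delta_nz by auto
    hence "\<Delta> / (w + w ^ q) = w - w ^ q"
      by (subst conic_eq(1)[OF that, symmetric]) (rule nonzero_mult_div_cancel_left)
    hence "((w + w ^ q) + \<Delta> / (w + w ^ q)) / 2 = (2 * w) / 2" unfolding mult_2 by simp
    thus ?thesis by simp
  qed
qed

end

text \<open>
  A rational point \<open>z0\<close> of the conic, and the zeros \<open>z1\<close>, \<open>z2\<close> of the root function in the coordinate
  \<open>z\<close>.
\<close>
locale conic_point = conic q ty \<Delta> for q :: nat and ty :: "'k::alg_closed_field itself" and \<Delta> :: 'k +
  fixes z0 z1 z2 :: 'k
  assumes z0: "z0 \<in> norm_coset" and z12: "z1 + z2 = 1" "z1 * z2 = \<Delta>"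
begin

text \<open>
  In the coordinate \<open>z\<close> the Frobenius map of the conic is \<open>twisted_frob\<close>, whose fixed points are the
  elements of \<open>norm_coset\<close>. The map \<open>moebius\<close> is the coordinate that sends \<open>z0\<close> to infinity and
  transforms \<open>twisted_frob\<close> into the ordinary Frobenius map.
\<close>
definition twisted_frob :: "'k \<Rightarrow> 'k" where "twisted_frob z = - \<Delta> / z ^ q"
definition moebius :: "'k \<Rightarrow> 'k" where "moebius z = \<Delta> * (z0 + z) / (z0 - z)"

lemma z0_nz: "z0 \<noteq> 0" using norm_coset_nz z0 by auto

lemma moebius_frob: assumes "z \<noteq> 0" "z \<noteq> z0" shows "moebius z ^ q = moebius (twisted_frob z)"
proof -
  define t where "t = z ^ q"
  have z0q: "z0 ^ q = - \<Delta> / z0" using z0 norm_coset_frob by auto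
  have t: "t \<noteq> 0" using assms by (simp add: t_def)
  have "t \<noteq> z0 ^ q" using assms(2) by (simp add: frob_inj1 t_def)
  have "moebius z ^ q = - \<Delta> * (- \<Delta> / z0 + t) / (- \<Delta> / z0 - t)"
    unfolding moebius_def power_divide power_mult_distrib frob_add1 frob_diff1 Delta_frob z0q t_def ..
  also have "- \<Delta> / z0 + t = (- \<Delta> + z0 * t) / z0" using z0_nz by (simp add: add_divide_distrib diff_divide_distrib)
  also have "- \<Delta> / z0 - t = (- \<Delta> - z0 * t) / z0" using z0_nz by (simp add: diff_divide_distrib)
  also have "- \<Delta> * ((- \<Delta> + z0 * t) / z0) / ((- \<Delta> - z0 * t) / z0) = - \<Delta> * (- \<Delta> + z0 * t) / (- \<Delta> - z0 * t)"
    using z0_nz by simp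
  also have "\<dots> = \<Delta> * (z0 * t - \<Delta>) / (z0 * t + \<Delta>)"
  proof -
    have "- \<Delta> * (- \<Delta> + z0 * t) = - (\<Delta> * (z0 * t - \<Delta>))" by (simp add: algebra_simps)
    moreover have "- \<Delta> - z0 * t = - (z0 * t + \<Delta>)" by simp
    ultimately show ?thesis by (simp only: minus_divide_divide)
  qed
  also have "\<dots> = \<Delta> * ((z0 * t - \<Delta>) / t) / ((z0 * t + \<Delta>) / t)" using t by simp
  also have "(z0 * t - \<Delta>) / t = z0 + twisted_frob z" using t by (simp add: twisted_frob_def t_def[symmetric] diff_divide_distrib)
  also have "(z0 * t + \<Delta>) / t = z0 - twisted_frob z" using t by (simp add: twisted_frob_def t_def[symmetric] add_divide_distrib)
  finally show ?thesis unfolding moebius_def .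
qed

lemma moebius_inj: assumes "z \<noteq> z0" "y \<noteq> z0" "moebius z = moebius y" shows "z = y"
proof -
  have "\<Delta> * ((z0 + z) * (z0 - y)) = \<Delta> * ((z0 + y) * (z0 - z))"
    using assms unfolding moebius_def by (simp add: frac_eq_eq mult.assoc)
  hence "(z0 + z) * (z0 - y) - (z0 + y) * (z0 - z) = 0" using Delta_nz by simp
  moreover have "(z0 + z) * (z0 - y) - (z0 + y) * (z0 - z) = 2 * (z0 * (z - y))"
    unfolding mult_2 by (simp only: algebra_simps)
  ultimately show ?thesis using z0_nz by simp
qed

lemma twisted_frob_z0: "twisted_frob z0 = z0"
  using z0 z0_nz unfolding twisted_frob_def by (simp add: norm_coset_frob Delta_nz)

text \<open>
  The \<open>i\<close>-th images of \<open>z1\<close> and \<open>z2\<close> under \<open>twisted_frob\<close> are the roots of the four polynomials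
  \<open>z\<^sup>2 - z + \<Delta>\<close>, \<open>z\<^sup>2 - z - \<Delta>\<close>, \<open>z\<^sup>2 + z + \<Delta>\<close>, \<open>z\<^sup>2 + z - \<Delta>\<close>, in this cyclic order. Since no two of
  them have a root in common, the eight conjugates are distinct.
\<close>
definition conj_root :: "nat \<Rightarrow> 'k \<Rightarrow> bool" where
  "conj_root i z \<longleftrightarrow> z * z + (if i < 2 then - z else z) = (if even i then - \<Delta> else \<Delta>)"

lemma conj_root_nz: "conj_root i z \<Longrightarrow> z \<noteq> 0" using Delta_nz by (auto simp: conj_root_def split: if_splits)

lemma conj_root_twisted_frob: assumes "conj_root i z" "i < 4" shows "conj_root (Suc i mod 4) (twisted_frob z)"
proof -
  define t where "t = z ^ q"
  have t: "t \<noteq> 0" using conj_root_nz[OF assms(1)] by (simp add: t_def)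
  have tt: "(z * z) ^ q = t * t" by (simp add: t_def power_mult_distrib)
  have frob: "t * t + (if i < 2 then - t else t) = (if even i then \<Delta> else - \<Delta>)"
  proof -
    have "(z * z + (if i < 2 then - z else z)) ^ q = (if even i then - \<Delta> else \<Delta>) ^ q"
      using assms(1) by (simp only: conj_root_def)
    thus ?thesis
      unfolding frob_add1 tt
      by (cases "i < 2"; cases "even i") (simp_all add: frob_minus1 Delta_frob t_def)
  qed
  have phi: "twisted_frob z = y" if "y * t = - \<Delta>" for y
    unfolding twisted_frob_def t_def[symmetric] that[symmetric] using t by simp
  have "i \<in> {0, 1, 2, 3}" using assms(2) by auto
  then consider "i = 0" | "i = 1" | "i = 2" | "i = 3" by blast
  thus ?thesis
  proof cases
    case 1
    have t2: "t * t - t = \<Delta>" using frob 1 by simp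
    have "(1 - t) * t = - \<Delta>" using arg_cong[OF t2, of uminus] by (simp add: algebra_simps)
    hence y: "twisted_frob z = 1 - t" by (rule phi)
    have "(1 - t) * (1 - t) + - (1 - t) = t * t - t" by (simp add: algebra_simps)
    thus ?thesis unfolding conj_root_def y t2 using 1 by simp
  next
    case 2
    have t2: "t * t - t = - \<Delta>" using frob 2 by simp
    have "(t - 1) * t = - \<Delta>" using arg_cong[OF t2, of uminus] by (simp add: algebra_simps)
    hence y: "twisted_frob z = t - 1" by (rule phi)
    have "(t - 1) * (t - 1) + (t - 1) = t * t - t" by (simp add: algebra_simps)
    thus ?thesis unfolding conj_root_def y t2 using 2 by simp
  next
    case 3
    have t2: "t * t + t = \<Delta>" using frob 3 by simp
    have "(- (t + 1)) * t = - \<Delta>" using arg_cong[OF t2, of uminus] by (simp add: algebra_simps)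
    hence y: "twisted_frob z = - (t + 1)" by (rule phi)
    have "- (t + 1) * - (t + 1) + - (t + 1) = t * t + t" by (simp add: algebra_simps)
    thus ?thesis unfolding conj_root_def y t2 using 3 by simp
  next
    case 4
    have t2: "t * t + t = - \<Delta>" using frob 4 by simp
    have "(t + 1) * t = t * t + t" by (simp add: algebra_simps)
    hence "(t + 1) * t = - \<Delta>" using t2 by (rule trans)
    hence y: "twisted_frob z = t + 1" by (rule phi)
    have "(t + 1) * (t + 1) + - (t + 1) = t * t + t" by (simp add: algebra_simps)
    thus ?thesis unfolding conj_root_def y t2 using 4 by simp
  qed
qed

lemma conj_root_disjoint: assumes "conj_root i z" "conj_root j z" "i < 4" "j < 4" shows "i = j"
proof -
  have nz: "z \<noteq> 0" "z * z \<noteq> 0" using conj_root_nz[OF assms(1)] by auto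
  have contra: False if ij: "i < j" "j < 4" "conj_root i z" "conj_root j z" for i j
  proof -
    have eqs: "conj_root 0 z \<longleftrightarrow> z * z - z = - \<Delta>" "conj_root 1 z \<longleftrightarrow> z * z - z = \<Delta>"
      "conj_root 2 z \<longleftrightarrow> z * z + z = - \<Delta>" "conj_root 3 z \<longleftrightarrow> z * z + z = \<Delta>"
      by (simp_all add: conj_root_def)
    have same: False if "u = - \<Delta>" "u = \<Delta>" for u
      using that eq_neg_self[of \<Delta>] Delta_nz by simp
    have opposite: False if "z * z - z = u" "z * z + z = u" for u
    proof -
      have "z * z - z = z * z + z" using that by simp
      hence "z * z + - z = z * z + z" by (simp only: diff_conv_add_uminus)
      hence "z = - z" by (metis add_left_cancel)
      thus False using eq_neg_self nz by blast
    qed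
    have square: False if "z * z - z = u" "z * z + z = - u" for u
    proof -
      have "z * z + z = - (z * z - z)" using that by simp
      hence "z + z * z = z + - (z * z)" by (simp only: minus_diff_eq) (simp only: diff_conv_add_uminus add.commute[of "z * z" z])
      hence "z * z = - (z * z)" by (metis add_left_cancel)
      thus False using eq_neg_self nz by blast
    qed
    have "(i = 0 \<and> j = 1) \<or> (i = 0 \<and> j = 2) \<or> (i = 0 \<and> j = 3) \<or> (i = 1 \<and> j = 2) \<or> (i = 1 \<and> j = 3) \<or> (i = 2 \<and> j = 3)"
      using ij(1,2) by linarith
    then consider "i = 0" "j = 1" | "i = 0" "j = 2" | "i = 0" "j = 3" | "i = 1" "j = 2" | "i = 1" "j = 3" | "i = 2" "j = 3"
      by blast
    thus False
    proof cases
      case 1 thus ?thesis using ij(3,4) same eqs by metis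
    next
      case 2 thus ?thesis using ij(3,4) opposite eqs by metis
    next
      case 3 thus ?thesis using ij(3,4) square[of "- \<Delta>"] eqs by simp
    next
      case 4 thus ?thesis using ij(3,4) square[of \<Delta>] eqs by simp
    next
      case 5 thus ?thesis using ij(3,4) opposite eqs by metis
    next
      case 6 thus ?thesis using ij(3,4) same eqs by metis
    qed
  qed
  show ?thesis using contra[of i j] contra[of j i] assms by (cases i j rule: linorder_cases) auto
qed

text \<open>
  The point \<open>z0\<close> is fixed by \<open>twisted_frob\<close>, but no root of one of the four quadratics is.
\<close>
lemma conj_root_ne_z0: assumes "conj_root i z" "i < 4" shows "z \<noteq> z0"
proof
  assume "z = z0"
  hence "conj_root (Suc i mod 4) z" using conj_root_twisted_frob[OF assms] twisted_frob_z0 by simp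
  hence "i = Suc i mod 4" by (rule conj_root_disjoint[OF assms(1) _ assms(2)]) simp
  moreover have "i \<noteq> Suc i mod 4" using assms(2) by (cases "i = 3") auto
  ultimately show False by contradiction
qed

lemma conj_root_z12: "conj_root 0 z1" "conj_root 0 z2"
proof -
  have "z1 * (z1 + z2) = z1" "(z1 + z2) * z2 = z2" by (simp_all only: z12(1) mult_1_right mult_1_left)
  hence "z1 * z1 - z1 = - (z1 * z2)" "z2 * z2 - z2 = - (z1 * z2)" by (simp_all add: algebra_simps)
  thus "conj_root 0 z1" "conj_root 0 z2" using z12(2) by (simp_all add: conj_root_def)
qed

lemma quadratic_factor: "(z - z1) * (z - z2) = z * z - z + \<Delta>"
proof -
  have "(z - z1) * (z - z2) = z * z - z * (z1 + z2) + z1 * z2" by (simp only: algebra_simps)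
  thus ?thesis by (simp only: z12 mult_1_right)
qed

lemma z1_ne_z2: "z1 \<noteq> z2"
proof
  assume eq: "z1 = z2"
  have "z1 + z1 = 1" using z12(1) eq by simp
  hence "z1 ^ q + z1 ^ q = z1 + z1" by (metis frob_add1 power_one)
  hence "2 * (z1 ^ q) = 2 * z1" by (simp only: mult_2)
  hence "z1 ^ q = z1" using mult_left_cancel[OF two_nz] by blast
  moreover have "\<Delta> = z1 * z1" using z12(2) eq by simp
  ultimately have "\<Delta> ^ q = \<Delta>" by (simp add: power_mult_distrib)
  thus False using Delta_not_fixed by contradiction
qed

text \<open>
  The square of the Frobenius map fixes \<open>\<Delta>\<close> and hence permutes \<open>z1\<close> and \<open>z2\<close>.
\<close>
lemma z12_F4: "z1 \<in> F 4" "z2 \<in> F 4"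
proof -
  have z2: "z2 = 1 - z1" using z12(1) by (simp add: algebra_simps)
  define y where "y = z1 ^ (q ^ 2)"
  have "(z1 * z1 - z1) ^ (q ^ 2) = (- \<Delta>) ^ (q ^ 2)" using conj_root_z12(1) by (simp add: conj_root_def)
  hence "y * y - y = - \<Delta>"
    unfolding frob_diff power_mult_distrib y_def using Delta_F2 by (simp add: F_iff frob_minus)
  hence "(y - z1) * (y - z2) = 0" unfolding quadratic_factor by simp
  hence "y = z1 \<or> y = z2" by simp
  moreover have "z1 ^ (q ^ 4) = y ^ (q ^ 2)" unfolding y_def frob_frob by simp
  moreover have "z2 ^ (q ^ 2) = 1 - y" unfolding z2 frob_diff y_def by simp
  ultimately have "z1 ^ (q ^ 4) = z1" using z2 y_def by auto
  thus "z1 \<in> F 4" by (simp add: F_iff)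
  thus "z2 \<in> F 4" unfolding z2 by (intro F_diff F_1)
qed

lemma z0_F4: "z0 \<in> F 4"
proof -
  have z0q: "z0 ^ q = - \<Delta> / z0" using z0 norm_coset_frob by auto
  have "(z0 ^ q) ^ q = (- \<Delta> / z0) ^ q" by (simp only: z0q)
  also have "\<dots> = (- \<Delta>) ^ q / z0 ^ q" by (rule power_divide)
  also have "\<dots> = - z0" unfolding z0q frob_minus1 Delta_frob using Delta_nz z0_nz by simp
  finally have "z0 ^ (q ^ 2) = - z0" by (simp add: power2_eq_square power_mult)
  hence "(z0 ^ (q ^ 2)) ^ (q ^ 2) = z0" by (simp add: frob_minus)
  thus ?thesis by (simp add: F_iff frob_frob)
qed

lemma iterate_twisted_frob:
  assumes "conj_root 0 z"
  shows "conj_root (i mod 4) ((twisted_frob ^^ i) z)" "moebius z ^ (q ^ i) = moebius ((twisted_frob ^^ i) z)"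
proof (induction i)
  case 0
  { case 1 show ?case using assms by simp }
  { case 2 show ?case by simp }
next
  case (Suc i)
  { case 1 show ?case using conj_root_twisted_frob[OF Suc(1)] by (simp add: mod_Suc_eq) }
  { case 2
    have "(twisted_frob ^^ i) z \<noteq> 0" "(twisted_frob ^^ i) z \<noteq> z0" using conj_root_nz[OF Suc(1)] conj_root_ne_z0[OF Suc(1)] by auto
    hence "(moebius z ^ (q ^ i)) ^ q = moebius (twisted_frob ((twisted_frob ^^ i) z))" using Suc(2) moebius_frob by simp
    thus ?case by (simp only: power_Suc2 power_mult funpow.simps o_apply) }
qed

lemma conj_inj: "inj_on (\<lambda>(\<beta>, i). \<beta> ^ (q ^ i)) ({moebius z1, moebius z2} \<times> {..<4})"
proof (rule inj_onI, clarify)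
  fix \<beta> i \<gamma> j
  assume \<beta>: "\<beta> \<in> {moebius z1, moebius z2}" and \<gamma>: "\<gamma> \<in> {moebius z1, moebius z2}" and ij: "i < 4" "j < 4"
    and eq: "\<beta> ^ (q ^ i) = \<gamma> ^ (q ^ j)"
  obtain z where z: "conj_root 0 z" "\<beta> = moebius z" using \<beta> conj_root_z12 by blast
  obtain y where y: "conj_root 0 y" "\<gamma> = moebius y" using \<gamma> conj_root_z12 by blast
  have Az: "conj_root i ((twisted_frob ^^ i) z)" and Ay: "conj_root j ((twisted_frob ^^ j) y)"
    using iterate_twisted_frob(1)[OF z(1), of i] iterate_twisted_frob(1)[OF y(1), of j] ij by simp_all
  have "moebius ((twisted_frob ^^ i) z) = moebius ((twisted_frob ^^ j) y)"
    using eq iterate_twisted_frob(2)[OF z(1), of i] iterate_twisted_frob(2)[OF y(1), of j] z(2) y(2) by simp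
  hence "(twisted_frob ^^ i) z = (twisted_frob ^^ j) y"
    by (rule moebius_inj[OF conj_root_ne_z0[OF Az ij(1)] conj_root_ne_z0[OF Ay ij(2)]])
  with Ay have "conj_root j ((twisted_frob ^^ i) z)" by simp
  hence "i = j" by (rule conj_root_disjoint[OF Az _ ij])
  thus "\<beta> = \<gamma> \<and> i = j" using eq by (simp add: frob_inj)
qed

lemma moebius_F4: "z \<in> F 4 \<Longrightarrow> moebius z \<in> F 4"
  unfolding moebius_def using z0_F4 F_mult_index[OF Delta_F2, of 2]
  by (intro F_divide F_mult F_add F_diff) simp_all

text \<open>
  The inverse of \<open>moebius\<close>.
\<close>
definition coset_param :: "'k \<Rightarrow> 'k" where "coset_param a = z0 * (a - \<Delta>) / (a + \<Delta>)"

lemma coset_param_in_norm_coset: assumes "a \<in> F 1" shows "coset_param a \<in> norm_coset"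
proof -
  have z0q: "z0 ^ q = - \<Delta> / z0" using z0 norm_coset_frob by auto
  have a: "a ^ q = a" using assms by (simp add: F_iff)
  have "coset_param a ^ q = (- \<Delta> / z0) * (a + \<Delta>) / (a - \<Delta>)"
    unfolding coset_param_def power_divide power_mult_distrib frob_add1 frob_diff1 Delta_frob a z0q by simp
  also have "\<dots> = - \<Delta> / coset_param a" unfolding coset_param_def by simp
  finally show ?thesis unfolding norm_coset_frob using shift_nz[OF assms] z0_nz by (simp add: coset_param_def)
qed

lemma moebius_coset_param: assumes "a \<in> F 1" shows "moebius (coset_param a) = a" "coset_param a \<noteq> z0"
proof -
  have nz: "a + \<Delta> \<noteq> 0" using shift_nz[OF assms] by simp
  have "z0 + coset_param a = (z0 * (a + \<Delta>) + z0 * (a - \<Delta>)) / (a + \<Delta>)"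
    unfolding coset_param_def add_divide_distrib using nz by simp
  also have "z0 * (a + \<Delta>) + z0 * (a - \<Delta>) = 2 * (z0 * a)" unfolding mult_2 by (simp add: algebra_simps)
  finally have p: "z0 + coset_param a = 2 * (z0 * a) / (a + \<Delta>)" .
  have "z0 - coset_param a = (z0 * (a + \<Delta>) - z0 * (a - \<Delta>)) / (a + \<Delta>)"
    unfolding coset_param_def diff_divide_distrib using nz by simp
  also have "z0 * (a + \<Delta>) - z0 * (a - \<Delta>) = 2 * (z0 * \<Delta>)" unfolding mult_2 by (simp only: algebra_simps)
  finally have n: "z0 - coset_param a = 2 * (z0 * \<Delta>) / (a + \<Delta>)" .
  show "moebius (coset_param a) = a" unfolding moebius_def p n using nz Delta_nz z0_nz by simp
  have "z0 - coset_param a \<noteq> 0" unfolding n using nz Delta_nz z0_nz by simp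
  thus "coset_param a \<noteq> z0" by simp
qed

lemma coset_param_moebius: assumes "z \<in> norm_coset" "z \<noteq> z0" shows "moebius z \<in> F 1" "coset_param (moebius z) = z"
proof -
  have z: "z \<noteq> 0" "z ^ q = - \<Delta> / z" using assms(1) norm_coset_frob by auto
  have "twisted_frob z = z" unfolding twisted_frob_def z(2) using z(1) Delta_nz by simp
  thus "moebius z \<in> F 1" using moebius_frob[OF z(1) assms(2)] by (simp add: F_iff)
  have nz: "z0 - z \<noteq> 0" using assms(2) by simp
  have "moebius z - \<Delta> = (\<Delta> * (z0 + z) - \<Delta> * (z0 - z)) / (z0 - z)"
    unfolding moebius_def diff_divide_distrib using nz by simp
  also have "\<Delta> * (z0 + z) - \<Delta> * (z0 - z) = 2 * (\<Delta> * z)" unfolding mult_2 by (simp only: algebra_simps)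
  finally have n: "moebius z - \<Delta> = 2 * (\<Delta> * z) / (z0 - z)" .
  have "moebius z + \<Delta> = (\<Delta> * (z0 + z) + \<Delta> * (z0 - z)) / (z0 - z)"
    unfolding moebius_def add_divide_distrib using nz by simp
  also have "\<Delta> * (z0 + z) + \<Delta> * (z0 - z) = 2 * (\<Delta> * z0)" unfolding mult_2 by (simp add: algebra_simps)
  finally have p: "moebius z + \<Delta> = 2 * (\<Delta> * z0) / (z0 - z)" .
  show "coset_param (moebius z) = z" unfolding coset_param_def p n using nz Delta_nz z0_nz by simp
qed

lemma sum_over_norm_coset: "(\<Sum>z\<in>norm_coset. g z) = g z0 + (\<Sum>a\<in>F 1. g (coset_param a))"
proof -
  have bij: "bij_betw coset_param (F 1) (norm_coset - {z0})"
    by (rule bij_betwI[where g = moebius]) (use coset_param_in_norm_coset moebius_coset_param coset_param_moebius in auto)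
  have "finite (norm_coset - {z0})" using bij_betw_finite[OF bij] finite_F[of 1] by simp
  hence "finite norm_coset" by simp
  hence "(\<Sum>z\<in>norm_coset. g z) = g z0 + (\<Sum>z\<in>norm_coset - {z0}. g z)" using z0 by (rule sum.remove)
  also have "(\<Sum>z\<in>norm_coset - {z0}. g z) = (\<Sum>a\<in>F 1. g (coset_param a))"
    by (rule sum.reindex_bij_betw[OF bij, symmetric])
  finally show ?thesis .
qed

text \<open>
  The value of the root function at infinity, in the coordinate \<open>a\<close>.
\<close>
definition lead_const :: 'k where "lead_const = (z0 - z1) * (z0 - z2) / (2 * z0)"

lemma shift_half: assumes "z \<noteq> 0" shows "(z + \<Delta> / z) / 2 - 1 / 2 = (z - z1) * (z - z2) / (2 * z)"
proof -
  have "(z - z1) * (z - z2) / (2 * z) = ((z * z - z + \<Delta>) / z) / 2"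
    unfolding quadratic_factor by simp
  also have "(z * z - z + \<Delta>) / z = z - 1 + \<Delta> / z"
    using assms by (simp add: add_divide_distrib diff_divide_distrib)
  finally show ?thesis by (simp add: add_divide_distrib diff_divide_distrib)
qed

lemma coset_param_minus: assumes "z \<noteq> z0" "a \<in> F 1" shows "coset_param a - z = (z0 - z) * (a - moebius z) / (a + \<Delta>)"
proof -
  have nz: "a + \<Delta> \<noteq> 0" using shift_nz[OF assms(2)] by simp
  have "(z0 - z) * moebius z = \<Delta> * (z0 + z)" unfolding moebius_def using assms(1) by simp
  hence "(z0 - z) * (a - moebius z) = z0 * (a - \<Delta>) - z * (a + \<Delta>)"
    by (simp add: right_diff_distrib) (simp add: algebra_simps)
  thus ?thesis unfolding coset_param_def using nz by (simp add: diff_divide_distrib)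
qed

lemma cancel_common_denominator:
  fixes p n s t a b c d :: 'k
  assumes "p \<noteq> 0" "n \<noteq> 0" "s \<noteq> 0" "t \<noteq> 0"
  shows "(a * b / p) * (c * d / p) / (t * (s * n / p)) = (a * c / (t * s)) * (b * d / (p * n))"
  using assms by (simp add: divide_simps)

lemma value_coset_param:
  assumes "a \<in> F 1"
  shows "(coset_param a + \<Delta> / coset_param a) / 2 - 1 / 2 = lead_const * ((a - moebius z1) * (a - moebius z2) / ((a + \<Delta>) * (a - \<Delta>)))"
proof -
  have nz: "a + \<Delta> \<noteq> 0" "a - \<Delta> \<noteq> 0" using shift_nz[OF assms] by auto
  have ne: "z1 \<noteq> z0" "z2 \<noteq> z0" using conj_root_ne_z0 conj_root_z12 by auto
  have "coset_param a \<noteq> 0" using coset_param_in_norm_coset[OF assms] norm_coset_nz by blast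
  hence "(coset_param a + \<Delta> / coset_param a) / 2 - 1 / 2 = (coset_param a - z1) * (coset_param a - z2) / (2 * coset_param a)" by (rule shift_half)
  also have "\<dots> = ((z0 - z1) * (a - moebius z1) / (a + \<Delta>)) * ((z0 - z2) * (a - moebius z2) / (a + \<Delta>)) / (2 * (z0 * (a - \<Delta>) / (a + \<Delta>)))"
    unfolding coset_param_minus[OF ne(1) assms] coset_param_minus[OF ne(2) assms] by (simp only: coset_param_def)
  also have "\<dots> = lead_const * ((a - moebius z1) * (a - moebius z2) / ((a + \<Delta>) * (a - \<Delta>)))"
    unfolding lead_const_def by (rule cancel_common_denominator) (use nz z0_nz in simp_all)
  finally show ?thesis .
qed

end

section \<open>Characters and points over the finite field\<close>

context conic
begin

lemma exists_conic_point: "\<exists>z0 z1 z2. conic_point q \<Delta> z0 z1 z2"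
proof -
  obtain z0 :: 'k where z0: "z0 ^ (q + 1) = - \<Delta>" using nth_root_exists[of "q + 1"] by auto
  obtain s :: 'k where s: "s ^ 2 = 1 - 4 * \<Delta>" using nth_root_exists[of 2] by auto
  have "(1 + s) / 2 + (1 - s) / 2 = 1" by (simp flip: add_divide_distrib)
  moreover have "(1 + s) / 2 * ((1 - s) / 2) = \<Delta>"
  proof -
    have "(1 + s) * (1 - s) = 1 - s ^ 2" by (simp add: algebra_simps power2_eq_square)
    thus ?thesis using s by simp
  qed
  ultimately have "conic_point q \<Delta> z0 ((1 + s) / 2) ((1 - s) / 2)"
    by unfold_locales (use z0 in \<open>simp add: norm_coset_def\<close>)
  thus ?thesis by blast
qed

text \<open>
  The sum over \<open>\<F>_q\<close> with the term \<open>1\<close> for infinity comes out, up to the factor \<open>\<chi>(\<mu> lead_const)\<close>. The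
  denominator \<open>Q = a\<^sup>2 - \<Delta>\<^sup>2\<close> lies in \<open>\<F>_q\<close>, and there \<open>scale\<close> allows \<open>1/Q\<close> to be replaced by \<open>Q^\<kappa>\<close>
  under the character.
\<close>
theorem conic_character_sum_bound:
  fixes \<chi> :: "'k \<Rightarrow> complex" and \<mu> :: 'k and \<kappa> :: nat
  assumes chi_0: "\<chi> 0 = 0" and chi_1: "\<chi> 1 = 1"
    and chi_mult: "\<And>x y. x \<in> F 4 \<Longrightarrow> y \<in> F 4 \<Longrightarrow> \<chi> (x * y) = \<chi> x * \<chi> y"
    and chi_norm: "\<And>x. x \<in> F 4 \<Longrightarrow> norm (\<chi> x) \<le> 1"
    and chi_sum: "(\<Sum>x\<in>F 4. \<chi> x) = 0"
    and mu: "\<mu> \<in> F 4"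
    and scale: "\<And>b. b \<in> F 1 \<Longrightarrow> b \<noteq> 0 \<Longrightarrow> \<chi> (b ^ (\<kappa> + 1)) = 1"
  shows "norm (\<Sum>w\<in>affine_conic. \<chi> (\<mu> * (w - 1 / 2))) \<le> (if \<kappa> = 0 then 6 else 8) * sqrt (real q)"
proof -
  obtain z0 z1 z2 where "conic_point q \<Delta> z0 z1 z2" using exists_conic_point by blast
  then interpret conic_point q ty \<Delta> z0 z1 z2 .
  have F1_F4: "a \<in> F 4" if "a \<in> F 1" for a using F_mult_index[OF that, of 4] by simp
  have Delta_F4: "\<Delta> \<in> F 4" using F_mult_index[OF Delta_F2, of 2] by simp
  interpret quadratic_character q ty \<chi> "moebius z1" "moebius z2" \<Delta> \<kappa>
  proof
    show "moebius z1 \<noteq> moebius z2" using moebius_inj[of z1 z2] z1_ne_z2 conj_root_ne_z0 conj_root_z12 by auto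
    show "\<chi> (a ^ (2 + 2 * \<kappa>)) = 1" if "a \<in> F 1" "a \<noteq> 0" for a
    proof -
      have "\<chi> ((a ^ 2) ^ (\<kappa> + 1)) = 1" using that by (intro scale F_power) auto
      thus ?thesis by (simp only: power_mult[symmetric]) (simp add: distrib_left)
    qed
  qed (use assms conj_inj moebius_F4 z12_F4 Delta_F2 Delta_not_fixed in auto)
  define b where "b = \<chi> (\<mu> * lead_const)"
  have mu_lead_const: "\<mu> * lead_const \<in> F 4"
    unfolding lead_const_def using mu z0_F4 z12_F4 F_add[OF F_1 F_1, of 4]
    by (intro F_mult F_divide F_diff) auto
  define h where "h = (\<lambda>a. (moebius z1 - a) * (moebius z2 - a) * ((\<Delta> - a) * (\<Delta> ^ q - a)) ^ \<kappa>)"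
  have h: "\<chi> (\<mu> * ((coset_param a + \<Delta> / coset_param a) / 2 - 1 / 2)) = b * \<chi> (h a)" if a: "a \<in> F 1" for a
  proof -
    define Q where "Q = (a + \<Delta>) * (a - \<Delta>)"
    have "Q \<noteq> 0" unfolding Q_def using shift_nz[OF a] by simp
    have Q2: "Q = (\<Delta> - a) * (\<Delta> ^ q - a)" by (simp add: Q_def Delta_frob algebra_simps)
    have aq: "a ^ q = a" using a by (simp add: F_iff)
    have "Q ^ q = Q" unfolding Q_def power_mult_distrib frob_add1 frob_diff1 Delta_frob aq by simp
    hence "Q \<in> F 1" by (simp add: F_iff)
    have mm: "moebius z1 \<in> F 4" "moebius z2 \<in> F 4" using moebius_F4 z12_F4 by auto
    define x where "x = (a - moebius z1) * (a - moebius z2) / Q"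
    have xF: "x \<in> F 4" unfolding x_def
      by (intro F_divide F_mult F_diff F1_F4 a mm \<open>Q \<in> F 1\<close>)
    have hx: "h a = x * Q ^ (\<kappa> + 1)"
    proof -
      have "(moebius z1 - a) * (moebius z2 - a) = (a - moebius z1) * (a - moebius z2)" by (simp only: algebra_simps)
      thus ?thesis unfolding h_def x_def Q2[symmetric] using \<open>Q \<noteq> 0\<close> by simp
    qed
    have "\<chi> (h a) = \<chi> x * \<chi> (Q ^ (\<kappa> + 1))"
      unfolding hx by (intro chi_mult xF F_power F1_F4 \<open>Q \<in> F 1\<close>)
    also have "\<dots> = \<chi> x" using scale[OF \<open>Q \<in> F 1\<close> \<open>Q \<noteq> 0\<close>] by simp
    finally have "\<chi> (h a) = \<chi> x" .
    moreover have "\<chi> (\<mu> * lead_const * x) = b * \<chi> x" unfolding b_def by (rule chi_mult[OF mu_lead_const xF])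
    moreover have "\<mu> * ((coset_param a + \<Delta> / coset_param a) / 2 - 1 / 2) = \<mu> * lead_const * x"
      unfolding value_coset_param[OF a] x_def Q_def by (simp only: mult.assoc)
    ultimately show ?thesis by (simp only:)
  qed
  have "(\<Sum>w\<in>affine_conic. \<chi> (\<mu> * (w - 1 / 2))) = (\<Sum>z\<in>norm_coset. \<chi> (\<mu> * ((z + \<Delta> / z) / 2 - 1 / 2)))"
    by (rule sum.reindex_bij_betw[OF bij_betw_norm_coset_affine_conic, symmetric])
  also have "\<dots> = \<chi> (\<mu> * ((z0 + \<Delta> / z0) / 2 - 1 / 2)) + (\<Sum>a\<in>F 1. \<chi> (\<mu> * ((coset_param a + \<Delta> / coset_param a) / 2 - 1 / 2)))"
    by (rule sum_over_norm_coset)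
  also have "\<chi> (\<mu> * ((z0 + \<Delta> / z0) / 2 - 1 / 2)) = b"
    unfolding shift_half[OF z0_nz] b_def lead_const_def ..
  also have "(\<Sum>a\<in>F 1. \<chi> (\<mu> * ((coset_param a + \<Delta> / coset_param a) / 2 - 1 / 2))) = (\<Sum>a\<in>F 1. b * \<chi> (h a))"
    by (intro sum.cong refl h)
  also have "b + \<dots> = b * (1 + (\<Sum>a\<in>F 1. \<chi> (h a)))" by (simp add: distrib_left sum_distrib_left)
  finally have "norm (\<Sum>w\<in>affine_conic. \<chi> (\<mu> * (w - 1 / 2))) = norm b * norm (1 + (\<Sum>a\<in>F 1. \<chi> (h a)))"
    by (simp add: norm_mult)
  also have "\<dots> \<le> 1 * norm (1 + (\<Sum>a\<in>F 1. \<chi> (h a)))"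
    unfolding b_def by (intro mult_right_mono chi_norm mu_lead_const) auto
  also have "\<dots> \<le> (if \<kappa> = 0 then 6 else 8) * sqrt (real q)"
    unfolding h_def mult_1_left by (rule quadratic_character_sum_bound)
  finally show ?thesis .
qed

end

lemma finite_field_power_card:
  fixes x :: "'a::{field,finite}"
  shows "x ^ CARD('a) = x"
proof (cases "x = 0")
  case False
  define E where "E = (\<Prod>y\<in>UNIV - {0::'a}. y)"
  have "bij_betw (\<lambda>y. x * y) (UNIV - {0}) (UNIV - {0})"
    by (rule bij_betwI[where g = "\<lambda>y. y / x"]) (use False in auto)
  hence "E = (\<Prod>y\<in>UNIV - {0}. x * y)" unfolding E_def by (rule prod.reindex_bij_betw[symmetric])
  also have "\<dots> = x ^ (CARD('a) - 1) * E" by (simp add: prod.distrib E_def)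
  finally have "x ^ (CARD('a) - 1) = 1" by (simp add: E_def)
  hence "x * x ^ (CARD('a) - 1) = x" by simp
  thus ?thesis by (metis power_eq_if zero_less_card_finite less_not_refl)
qed (simp add: zero_less_card_finite)

text \<open>
  Each point of the conic has a unique representative with \<open>u = 1\<close>. A point with \<open>u = 0\<close> would have
  \<open>w^q\<close> equal to \<open>w\<close> or \<open>-w\<close>, hence \<open>w^(q\<^sup>2) = w\<close>, and on \<open>V_minus\<close> this forces \<open>w = 0\<close>.
\<close>
lemma sum_conic_points:
  fixes \<Delta> :: "'a::{field,finite}" and g :: "'a \<Rightarrow> complex"
  assumes "odd q" and two: "(2 :: 'a) \<noteq> 0"
  shows "(\<Sum>P\<in>conic_points q \<Delta>. g (root_function P)) =
    (\<Sum>w | w ^ (q\<^sup>2) = - w \<and> w\<^sup>2 - w ^ (2 * q) = \<Delta>. g (w - 1 / 2))"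
proof -
  define affine_conic where "affine_conic = {w :: 'a. w ^ (q\<^sup>2) = - w \<and> w\<^sup>2 - w ^ (2 * q) = \<Delta>}"
  define cls where "cls = (\<lambda>w :: 'a. proj_rel q `` {(1, w)})"
  have aniso: "w = 0" if w: "w ^ (q\<^sup>2) = - w" "w\<^sup>2 = w ^ (2 * q)" for w :: 'a
  proof -
    have "w\<^sup>2 = (w ^ q)\<^sup>2" using w(2) by (metis mult.commute power_mult)
    hence "w ^ q = w \<or> w ^ q = - w" using power2_eq_iff[of w "w ^ q"] by (metis minus_minus)
    moreover have "w ^ (q\<^sup>2) = (w ^ q) ^ q" by (simp add: power2_eq_square power_mult)
    ultimately have "w ^ (q\<^sup>2) = w" using \<open>odd q\<close> by (auto simp: power_minus_odd)
    hence "w + w = 0" using w(1) by (metis add.right_inverse)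
    hence "2 * w = 0" by (simp only: mult_2)
    thus ?thesis using two by simp
  qed
  have vec: "(1, w) \<in> proj_vectors q" if "w \<in> affine_conic" for w
    using that by (simp add: proj_vectors_def subfield_of_order_def V_minus_def affine_conic_def)
  have self: "(1, w) \<in> cls w" if "w \<in> affine_conic" for w
    unfolding cls_def Image_singleton_iff by (rule equivE[OF proj_rel_equiv]) (use vec[OF that] in \<open>auto simp: refl_on_def\<close>)
  have cls_space: "cls w \<in> proj_space q" if "w \<in> affine_conic" for w
    unfolding cls_def proj_space_def using vec[OF that] by (rule quotientI)
  have root: "root_function (cls w) = w - 1 / 2" if "w \<in> affine_conic" for w
    using root_function_class[OF cls_space[OF that] self[OF that]] by simp
  have scale: "Phi q (c * w) = c\<^sup>2 * Phi q w" if "c ^ q = c" for c w :: 'a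
  proof -
    have "c ^ (2 * q) = c\<^sup>2" using that by (metis mult.commute power_mult)
    thus ?thesis by (simp add: Phi_def power_mult_distrib right_diff_distrib)
  qed
  have bij: "bij_betw cls affine_conic (conic_points q \<Delta>)"
  proof (rule bij_betw_imageI)
    show "inj_on cls affine_conic"
    proof (rule inj_onI)
      fix w w' assume w: "w \<in> affine_conic" "w' \<in> affine_conic" "cls w = cls w'"
      have "w - 1 / 2 = w' - 1 / 2" using root[OF w(1)] root[OF w(2)] w(3) by metis
      thus "w = w'" by simp
    qed
    show "cls ` affine_conic = conic_points q \<Delta>"
    proof (intro equalityI subsetI)
      fix P assume "P \<in> cls ` affine_conic"
      then obtain w where w: "w \<in> affine_conic" "P = cls w" by auto
      have "Phi q w' = \<Delta> * u\<^sup>2" if "(u, w') \<in> cls w" for u w'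
      proof -
        from that obtain c where c: "c ^ q = c" "u = c" "w' = c * w"
          unfolding cls_def Image_singleton_iff proj_rel_iff by auto
        have "Phi q w = \<Delta>" using w(1) by (simp add: affine_conic_def Phi_def)
        thus ?thesis using scale[OF c(1)] c by simp
      qed
      thus "P \<in> conic_points q \<Delta>" using w cls_space by (auto simp: conic_points_def)
    next
      fix P assume P: "P \<in> conic_points q \<Delta>"
      then obtain u w where uw: "(u, w) \<in> proj_vectors q" "P = proj_rel q `` {(u, w)}"
        unfolding conic_points_def proj_space_def by (auto elim!: quotientE)
      have "((u, w), (u, w)) \<in> proj_rel q"
        by (rule equivE[OF proj_rel_equiv]) (use uw(1) in \<open>auto simp: refl_on_def\<close>)
      hence "(u, w) \<in> P" using uw(2) by simp
      hence Phi: "Phi q w = \<Delta> * u\<^sup>2" using P by (auto simp: conic_points_def)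
      have u: "u ^ q = u" and w: "w ^ (q\<^sup>2) = - w" and nz: "u \<noteq> 0 \<or> w \<noteq> 0"
        using uw(1) by (auto simp: proj_vectors_def subfield_of_order_def V_minus_def)
      have "u \<noteq> 0"
      proof
        assume "u = 0"
        hence "w\<^sup>2 = w ^ (2 * q)" using Phi by (simp add: Phi_def)
        thus False using aniso[OF w] nz \<open>u = 0\<close> by simp
      qed
      define v where "v = inverse u * w"
      have iu: "inverse u ^ q = inverse u" using u by (simp add: power_inverse)
      hence "inverse u ^ (q\<^sup>2) = inverse u" by (simp add: power2_eq_square power_mult)
      hence v1: "v ^ (q\<^sup>2) = - v" by (simp add: v_def power_mult_distrib w)
      have "Phi q v = \<Delta>" unfolding v_def scale[OF iu] Phi using \<open>u \<noteq> 0\<close> by (simp add: power_inverse)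
      hence v: "v \<in> affine_conic" using v1 by (simp add: affine_conic_def Phi_def)
      have "((u, w), (1, v)) \<in> proj_rel q"
        unfolding proj_rel_iff using uw(1) vec[OF v] iu \<open>u \<noteq> 0\<close>
        by (auto simp: v_def intro!: exI[of _ "inverse u"])
      hence "P = cls v" unfolding uw(2) cls_def using equiv_class_eq[OF proj_rel_equiv] by blast
      thus "P \<in> cls ` affine_conic" using v by blast
    qed
  qed
  have "(\<Sum>P\<in>conic_points q \<Delta>. g (root_function P)) = (\<Sum>w\<in>affine_conic. g (root_function (cls w)))"
    by (rule sum.reindex_bij_betw[OF bij, symmetric])
  also have "\<dots> = (\<Sum>w\<in>affine_conic. g (w - 1 / 2))" by (intro sum.cong refl) (simp add: root)
  finally show ?thesis unfolding affine_conic_def .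
qed

lemma mult_character_1: assumes "mult_character \<chi>" shows "\<chi> (1::'a::field) = 1"
proof -
  have "\<chi> (1 * 1) = \<chi> 1 * \<chi> 1" "\<chi> 1 \<noteq> 0"
    using assms unfolding mult_character_def by (metis one_neq_zero)+
  thus ?thesis by simp
qed

lemma mult_character_mult: "mult_character \<chi> \<Longrightarrow> \<chi> (x * y) = \<chi> x * \<chi> (y::'a::field)"
  unfolding mult_character_def by (metis mult_eq_0_iff)

lemma mult_character_power:
  assumes "mult_character \<chi>" shows "\<chi> ((x::'a::field) ^ n) = \<chi> x ^ n"
  by (induction n) (simp_all add: mult_character_1[OF assms] mult_character_mult[OF assms])

lemma mult_character_power_card:
  fixes x :: "'a::{field,finite}"
  assumes "mult_character \<chi>" "x \<noteq> 0"
  shows "\<chi> x ^ (CARD('a) - 1) = 1"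
proof -
  have "x * x ^ (CARD('a) - 1) = x" using finite_field_power_card[of x] by (metis power_eq_if zero_less_card_finite less_not_refl)
  hence "x ^ (CARD('a) - 1) = 1" using assms(2) by simp
  thus ?thesis using mult_character_power[OF assms(1), of x "CARD('a) - 1"] mult_character_1[OF assms(1)] by simp
qed

lemma card_gt_1: "CARD('a::{field,finite}) > 1"
proof -
  have "card {0, 1 :: 'a} \<le> CARD('a)" by (rule card_mono) auto
  thus ?thesis by simp
qed

lemma mult_character_norm_le_1:
  fixes x :: "'a::{field,finite}"
  assumes "mult_character \<chi>" shows "norm (\<chi> x) \<le> 1"
proof (cases "x = 0")
  case True
  thus ?thesis using assms by (simp add: mult_character_def)
next
  case False
  have "norm (\<chi> x) ^ (CARD('a) - 1) = 1 ^ (CARD('a) - 1)"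
    using mult_character_power_card[OF assms False] by (simp flip: norm_power)
  hence "norm (\<chi> x) = 1" by (rule power_eq_imp_eq_base) (use card_gt_1[where 'a = 'a] in simp_all)
  thus ?thesis by simp
qed

lemma sum_mult_character:
  fixes \<chi> :: "'a::{field,finite} \<Rightarrow> complex"
  assumes "mult_character \<chi>" "\<chi> \<noteq> trivial_character"
  shows "(\<Sum>x\<in>UNIV. \<chi> x) = 0"
proof -
  obtain y where y: "y \<noteq> 0" "\<chi> y \<noteq> 1"
    using assms by (auto simp: mult_character_def trivial_character_def fun_eq_iff split: if_splits)
  have "bij (\<lambda>x. y * x)"
    by (rule bij_betwI[where g = "\<lambda>x. x / y"]) (use y in auto)
  hence "(\<Sum>x\<in>UNIV. \<chi> x) = (\<Sum>x\<in>UNIV. \<chi> (y * x))" by (rule sum.reindex_bij_betw[symmetric])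
  also have "\<dots> = \<chi> y * (\<Sum>x\<in>UNIV. \<chi> x)" by (simp add: mult_character_mult[OF assms(1)] sum_distrib_left)
  finally show ?thesis using y(2) by simp
qed

lemma character_order_power:
  fixes \<chi> :: "'a::{field,finite} \<Rightarrow> complex"
  assumes "mult_character \<chi>" "x \<noteq> 0"
  shows "\<chi> x ^ character_order \<chi> = 1"
proof -
  have "CARD('a) - 1 > 0 \<and> (\<lambda>x. \<chi> x ^ (CARD('a) - 1)) = trivial_character"
    using mult_character_power_card[OF assms(1)] assms(1) card_gt_1[where 'a = 'a]
    by (auto simp: trivial_character_def fun_eq_iff mult_character_def)
  hence "(\<lambda>x. \<chi> x ^ character_order \<chi>) = trivial_character"
    unfolding character_order_def by (rule LeastI2) auto
  thus ?thesis using assms(2) by (simp add: trivial_character_def fun_eq_iff)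
qed

section \<open>The bound\<close>

lemma CHAR_of_card_prime_power:
  assumes "primepow q" "CARD('a::{field,finite}) = q ^ 4"
  shows "prime CHAR('a)" "\<exists>s>0. q = CHAR('a) ^ s"
proof -
  obtain p n where p: "prime p" "n > 0" "q = p ^ n" using assms(1) by (auto simp: primepow_def)
  have pos: "CHAR('a) > 0" by (rule finite_imp_CHAR_pos) simp
  show prime: "prime CHAR('a)" using prime_CHAR_semidom[OF pos] .
  have "CHAR('a) dvd q ^ 4" using CHAR_dvd_CARD[where 'a = 'a] assms(2) by simp
  hence "CHAR('a) dvd p" using prime p(3) by (metis prime_dvd_power)
  hence "CHAR('a) = p" using prime p(1) primes_dvd_imp_eq by blast
  thus "\<exists>s>0. q = CHAR('a) ^ s" using p by blast
qed

theorem theorem3p2: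
  fixes q d :: nat
    and \<mu> \<Delta> :: "'a::{field,finite}"
    and \<chi> :: "'a \<Rightarrow> complex"
  assumes "primepow q" and "odd q"
    and "CARD('a) = q ^ 4"
    and "\<mu> \<in> subfield_of_order q" and "\<mu> \<noteq> 0"
    and "\<Delta> \<in> subfield_of_order (q ^ 2)" and "\<Delta> \<noteq> 0" and "\<Delta> ^ q = - \<Delta>"
    and "mult_character \<chi>" and "\<chi> \<noteq> trivial_character"
    and "character_order \<chi> = d"
  shows "cmod (S_sum q \<mu> \<Delta> \<chi>) \<le>
    (if d dvd (q + 1) * (q ^ 2 + 1) then 6 * sqrt (real q) else 8 * sqrt (real q))"
proof -
  interpret conic q "TYPE('a alg_closure)" "to_ac \<Delta>"
  proof
    show "to_ac \<Delta> ^ q = - to_ac \<Delta>" using assms(8) by (metis to_ac_power to_ac_minus)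
  qed (use CHAR_of_card_prime_power[OF assms(1,3)] assms in auto)
  have range: "range (to_ac :: 'a \<Rightarrow> _) = F 4"
  proof (rule card_subset_eq)
    show "finite (F 4)" by (rule finite_F) simp
    show "range (to_ac :: 'a \<Rightarrow> _) \<subseteq> F 4"
    proof
      fix y :: "'a alg_closure" assume "y \<in> range to_ac"
      then obtain x where "y = to_ac x" by auto
      moreover have "x ^ (q ^ 4) = x" using finite_field_power_card[of x] assms(3) by simp
      ultimately show "y \<in> F 4" by (metis F_iff to_ac_power)
    qed
    show "card (range (to_ac :: 'a \<Rightarrow> _)) = card (F 4)"
      using assms(3) card_F[of 4] by (simp add: card_image inj_to_ac)
  qed
  have F4E: "\<exists>y. x = to_ac y" if "x \<in> F 4" for x using that range by auto
  define \<psi> where "\<psi> = (\<lambda>x :: 'a alg_closure. \<chi> (of_ac x))"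
  have psi: "\<psi> (to_ac x) = \<chi> x" for x by (simp add: \<psi>_def)
  have bound: "cmod (S_sum q \<mu> \<Delta> \<chi>) \<le> (if \<kappa> = 0 then 6 else 8) * sqrt (real q)"
    if scale: "\<And>b. b \<in> F 1 \<Longrightarrow> b \<noteq> 0 \<Longrightarrow> \<psi> (b ^ (\<kappa> + 1)) = 1" for \<kappa>
  proof -
    have two: "(2 :: 'a) \<noteq> 0"
    proof
      assume "(2 :: 'a) = 0"
      hence "to_ac (2 :: 'a) = 0" by simp
      thus False using two_nz by simp
    qed
    define V where "V = {w :: 'a. w ^ (q\<^sup>2) = - w \<and> w\<^sup>2 - w ^ (2 * q) = \<Delta>}"
    have affine_conic_eq: "affine_conic = to_ac ` V"
    proof (intro equalityI subsetI)
      fix w assume w: "w \<in> affine_conic"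
      hence w2: "w ^ (q\<^sup>2) = - w" by (simp add: affine_conic_def)
      have "w ^ (q ^ 4) = (w ^ (q\<^sup>2)) ^ (q\<^sup>2)" unfolding frob_frob by simp
      also have "\<dots> = w" unfolding w2 frob_minus by simp
      finally obtain v where v: "w = to_ac v" using F4E by (auto simp: F_iff)
      have "to_ac (v ^ (q\<^sup>2)) = to_ac (- v)" "to_ac (v\<^sup>2 - v ^ (2 * q)) = to_ac \<Delta>"
        using w by (simp_all add: affine_conic_def v)
      hence "v \<in> V" unfolding V_def to_ac_eq_iff by blast
      thus "w \<in> to_ac ` V" using v by blast
    next
      fix w assume "w \<in> to_ac ` V"
      then obtain v where v: "w = to_ac v" "v ^ (q\<^sup>2) = - v" "v\<^sup>2 - v ^ (2 * q) = \<Delta>" by (auto simp: V_def)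
      have "to_ac (v ^ (q\<^sup>2)) = to_ac (- v)" "to_ac (v\<^sup>2 - v ^ (2 * q)) = to_ac \<Delta>"
        by (simp_all only: v)
      thus "w \<in> affine_conic" by (simp add: affine_conic_def v(1))
    qed
    have "S_sum q \<mu> \<Delta> \<chi> = (\<Sum>v\<in>V. \<chi> (\<mu> * (v - 1 / 2)))"
      unfolding S_sum_def V_def using sum_conic_points[OF assms(2) two, of "\<lambda>x. \<chi> (\<mu> * x)" \<Delta>] by simp
    also have "\<dots> = (\<Sum>v\<in>V. \<psi> (to_ac \<mu> * (to_ac v - 1 / 2)))"
    proof (intro sum.cong refl)
      fix v
      have "to_ac \<mu> * (to_ac v - 1 / 2) = to_ac (\<mu> * (v - 1 / 2))" by simp
      thus "\<chi> (\<mu> * (v - 1 / 2)) = \<psi> (to_ac \<mu> * (to_ac v - 1 / 2))" by (simp only: psi)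
    qed
    also have "\<dots> = (\<Sum>w\<in>affine_conic. \<psi> (to_ac \<mu> * (w - 1 / 2)))"
      unfolding affine_conic_eq by (subst sum.reindex) (auto simp: inj_on_def)
    also have "cmod \<dots> \<le> (if \<kappa> = 0 then 6 else 8) * sqrt (real q)"
    proof (rule conic_character_sum_bound)
      show "\<psi> 0 = 0" using assms(9) by (simp add: \<psi>_def mult_character_def)
      show "\<psi> 1 = 1" using psi[of 1] mult_character_1[OF assms(9)] by simp
      show "\<psi> (x * y) = \<psi> x * \<psi> y" if xF: "x \<in> F 4" and yF: "y \<in> F 4" for x y
      proof -
        obtain x' y' where xy: "x = to_ac x'" "y = to_ac y'" using F4E[OF xF] F4E[OF yF] by blast
        have "x * y = to_ac (x' * y')" by (simp add: xy)
        thus ?thesis by (simp only: psi xy mult_character_mult[OF assms(9)])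
      qed
      show "cmod (\<psi> x) \<le> 1" for x unfolding \<psi>_def by (rule mult_character_norm_le_1[OF assms(9)])
      show "(\<Sum>x\<in>F 4. \<psi> x) = 0"
        unfolding range[symmetric] using sum_mult_character[OF assms(9,10)]
        by (simp add: sum.reindex inj_to_ac psi)
      show "to_ac \<mu> \<in> F 4" using range by blast
    qed (use scale in auto)
    finally show ?thesis .
  qed
  show ?thesis
  proof (cases "d dvd (q + 1) * (q ^ 2 + 1)")
    case True
    then obtain t where t: "(q + 1) * (q ^ 2 + 1) = d * t" by (elim dvdE)
    (* Elements of the field of order q are norms, that is n-th powers, from the field of order q^4,
       and the n-th power of the character is trivial. *)
    define n where "n = (q + 1) * (q ^ 2 + 1)"
    have "\<psi> (b ^ (0 + 1)) = 1" if b: "b \<in> F 1" "b \<noteq> 0" for b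
    proof -
      have "n > 0" by (simp add: n_def)
      then obtain y where y: "y ^ n = b" using nth_root_exists by blast
      have "y \<noteq> 0" using y b \<open>n > 0\<close> by (auto simp: power_0_left)
      obtain r where r: "q = Suc r" using q_pos(2) not0_implies_Suc by blast
      have "b ^ r = 1"
      proof -
        have "b ^ q = b" using b(1) by (simp add: F_iff)
        hence "b * b ^ r = b" by (simp only: r power_Suc)
        thus ?thesis using b(2) by simp
      qed
      have "q ^ 4 = n * r + 1" unfolding n_def r by (simp add: power2_eq_square eval_nat_numeral algebra_simps)
      hence "y ^ (q ^ 4) = (y ^ n) ^ r * y" by (simp only: power_add power_mult power_one_right)
      hence "y \<in> F 4" by (simp add: F_iff y \<open>b ^ r = 1\<close>)
      then obtain x where x: "y = to_ac x" using F4E by blast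
      have "x \<noteq> 0" using x \<open>y \<noteq> 0\<close> by auto
      have "b = to_ac (x ^ n)" using y x by simp
      hence "\<psi> b = \<chi> x ^ n" by (simp only: psi mult_character_power[OF assms(9)])
      also have "\<dots> = (\<chi> x ^ character_order \<chi>) ^ t" unfolding n_def t assms(11) by (rule power_mult)
      also have "\<dots> = 1" using character_order_power[OF assms(9) \<open>x \<noteq> 0\<close>] by simp
      finally show ?thesis by simp
    qed
    from bound[OF this] True show ?thesis by simp
  next
    case False
    (* The choice \<kappa> = q - 2 makes b ^ \<kappa> the inverse of b; it is positive as q is at least 3. *)
    have "\<psi> (b ^ (q - 2 + 1)) = 1" if b: "b \<in> F 1" "b \<noteq> 0" for b
    proof -
      have "Suc (q - 2 + 1) = q" using q_ge_3 by simp
      hence "b * b ^ (q - 2 + 1) = b ^ q" by (metis power_Suc)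
      also have "\<dots> = b" using b(1) by (simp add: F_iff)
      finally have "b ^ (q - 2 + 1) = 1" using b(2) by simp
      thus ?thesis using psi[of 1] mult_character_1[OF assms(9)] by simp
    qed
    from bound[OF this] False q_ge_3 show ?thesis by simp
  qed
qed

end
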